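(* Let $G=(V,E)$ be an infinite, locally finite weighted graph with symmetric weight $\omega$, and let $n>0$, $\alpha>0$. Assume that $G$ satisfies the curvature-dimension condition $CDE'(n,0)$ and the condition $\Delta(\alpha)$. Let $C(n)$ be a volume doubling constant of $G$, i.e. $V(x,2r)\le C(n)V(x,r)$ for all $x\in V$, $r>0$, put $D=D(n)=\log_2C(n)$, and suppose $D>2$. Assume also the polynomial volume growth condition: there is $c_0>0$ such that $V(x,r)\ge c_0r^{D}$ for all $x\in V$, $r\ge0$. Then all of the following hold: 1. there is $c>0$ with $\|f\|_{\frac{2D}{D-2}}^2\le c\,\langle\Gamma(f)\rangle$ for every finitely supported $f:V\to\mathbb{R}$; 2. there is $c>0$ with $\|f\|_2^{2+\frac4D}\le c\,\langle\Gamma(f)\rangle\|f\|_1^{\frac4D}$ for every finitely supported $f:V\to\mathbb{R}$; 3. there is $c>0$ with $\lambda_1(\Omega)\ge c\,V(\Omega)^{-\frac2D}$ for every nonempty finite $\Omega\subset V$; 4. there is $C>0$ with $\sup_{x,y\in V}\frac{p_k(x,y)}{m(y)}\le Ck^{-\frac D2}$ for all integers $k\ge1$; 5. there is $C>0$ with $\sup_{x,y\in V}p(t,x,y)\le Ct^{-\frac D2}$ for all $t>0$; 6. there is a constant $c(n)\in\mathbb{R}$ such that for all $\varepsilon>0$ and every finitely supported $f:V\to[0,\infty)$, $$\langle f^2\log f\rangle-\|f\|_2^2\log\|f\|_2\le\varepsilon\langle\Gamma(f)\rangle+\Big(c(n)-\frac{D(n)}4\log\varepsilon\Big)\|f\|_2^2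 .$$
   Context: $G=(V,E)$ is an infinite graph with a symmetric weight function $\omega:V\times V\to[0,\infty)$, $\omega_{xy}=\omega_{yx}$; $x\sim y$ iff $\omega_{xy}>0$; loops are allowed. $G$ is locally finite: each vertex has finitely many neighbours. The degree $m(x)=\sum_{y\sim x}\omega_{xy}$ satisfies $0<m(x)<\infty$. With $d$ the graph distance, $B(x,r)=\{y\in V:d(x,y)\le r\}$; $V(A)=\sum_{x\in A}m(x)$ for $A\subset V$, and $V(x,r)=V(B(x,r))$. Norms: $\|f\|_p=\big(\sum_xm(x)|f(x)|^p\big)^{1/p}$ for $1\le p<\infty$. Notation: $\langle f\rangle=\sum_{x\in V}m(x)f(x)$. Convention: $0\log0=0$. Laplacian: $\Delta f(x)=\frac1{m(x)}\sum_{y\sim x}\omega_{xy}(f(y)-f(x))$. Gradient form: $\Gamma(f,g)(x)=\frac1{2m(x)}\sum_{y\sim x}\omega_{xy}(f(y)-f(x))(g(y)-g(x))$, $\Gamma(f)=\Gamma(f,f)$. Iterated gradient form: $2\Gamma_2(f)=\Delta\Gamma(f)-2\Gamma(f,\Delta f)$. For positive $f:V\to(0,\infty)$, $\widetilde{\Gamma_2}(f)=\Gamma_2(f)-\Gamma\big(f,\frac{\Gamma(f)}{f}\big)$. $CDE'(n,K)$: for every $x\in V$ and every $f:V\to(0,\infty)$, $\widetilde{\Gamma_2}(f)(x)\ge\frac1nf(x)^2(\Delta\log f)(x)^2+K\,\Gamma(f)(x)$. $\Delta(\alpha)$: every vertex has a loop ($x\sim x$ for all $x$), and $\omega_{xy}\ge\alpha\,m(x)$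 whenever $x\sim y$. It is a known theorem (from earlier work) that $CDE'(n,0)$ together with $\Delta(\alpha)$ implies the volume doubling property $V(x,2r)\le C(n)V(x,r)$ with a constant written $C(n)$; $D(n)=\log_2C(n)$ refers to this constant. For nonempty finite $\Omega\subset V$, $\lambda_1(\Omega)=\inf\big\{\frac{\langle\Gamma(f)\rangle}{\|f\|_2^2}:f\ne0,\ \mathrm{supp}(f)\subset\Omega\big\}$. $\Delta$ is bounded and self-adjoint on $\ell^2(V,m)$; $P_t=e^{t\Delta}$ is the heat semigroup, and $p(t,x,y)$ the heat kernel: $P_tf(x)=\sum_{y}m(y)p(t,x,y)f(y)$. Discrete-time heat kernel: $p(x,y)=\omega_{xy}/m(x)$, $p_0(x,y)=\delta_{xy}$, $p_{k+1}(x,z)=\sum_yp(x,y)p_k(y,z)$. *)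

theory Defs
  imports "HOL-Analysis.Analysis"
begin

text \<open>A weighted graph is given by its weight function; the vertex set is the whole type.
  Connectedness is not assumed.\<close>

definition nbrs :: "('v \<Rightarrow> 'v \<Rightarrow> real) \<Rightarrow> 'v \<Rightarrow> 'v set" where
  "nbrs w x = {y. w x y > 0}"

definition deg :: "('v \<Rightarrow> 'v \<Rightarrow> real) \<Rightarrow> 'v \<Rightarrow> real" where
  "deg w x = (\<Sum>y\<in>nbrs w x. w x y)"

definition weighted_graph :: "('v \<Rightarrow> 'v \<Rightarrow> real) \<Rightarrow> bool" where
  "weighted_graph w \<longleftrightarrow>
     infinite (UNIV :: 'v set) \<and>
     (\<forall>x y. w x y \<ge> 0) \<and>
     (\<forall>x y. w x y = w y x) \<and>
     (\<forall>x. finite (nbrs w x)) \<and>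
     (\<forall>x. deg w x > 0)"

text \<open>Length of a shortest walk; \<open>\<infinity>\<close> (the infimum of the empty set) between
  different components.\<close>

definition gdist :: "('v \<Rightarrow> 'v \<Rightarrow> real) \<Rightarrow> 'v \<Rightarrow> 'v \<Rightarrow> enat" where
  "gdist w x y = (INF k\<in>{k. (x, y) \<in> {(u, v). v \<in> nbrs w u} ^^ k}. enat k)"

definition gball :: "('v \<Rightarrow> 'v \<Rightarrow> real) \<Rightarrow> 'v \<Rightarrow> real \<Rightarrow> 'v set" where
  "gball w x r = {y. ereal_of_enat (gdist w x y) \<le> ereal r}"

text \<open>Only used for finite sets (balls are finite by local finiteness).\<close>

definition vol :: "('v \<Rightarrow> 'v \<Rightarrow> real) \<Rightarrow> 'v set \<Rightarrow> real" where
  "vol w A = (\<Sum>x\<in>A. deg w x)"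

definition supp :: "('v \<Rightarrow> real) \<Rightarrow> 'v set" where
  "supp f = {x. f x \<noteq> 0}"

definition integ :: "('v \<Rightarrow> 'v \<Rightarrow> real) \<Rightarrow> ('v \<Rightarrow> real) \<Rightarrow> real" where
  "integ w f = (\<Sum>\<^sub>\<infinity>x. deg w x * f x)"

definition lpnorm :: "('v \<Rightarrow> 'v \<Rightarrow> real) \<Rightarrow> real \<Rightarrow> ('v \<Rightarrow> real) \<Rightarrow> real" where
  "lpnorm w p f = (\<Sum>\<^sub>\<infinity>x. deg w x * \<bar>f x\<bar> powr p) powr (1 / p)"

definition l2 :: "('v \<Rightarrow> 'v \<Rightarrow> real) \<Rightarrow> ('v \<Rightarrow> real) set" where
  "l2 w = {f. (\<lambda>x. deg w x * \<bar>f x\<bar>\<^sup>2) summable_on UNIV}"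

definition lap :: "('v \<Rightarrow> 'v \<Rightarrow> real) \<Rightarrow> ('v \<Rightarrow> real) \<Rightarrow> 'v \<Rightarrow> real" where
  "lap w f x = 1 / deg w x * (\<Sum>y\<in>nbrs w x. w x y * (f y - f x))"

definition Gam :: "('v \<Rightarrow> 'v \<Rightarrow> real) \<Rightarrow> ('v \<Rightarrow> real) \<Rightarrow> ('v \<Rightarrow> real) \<Rightarrow> 'v \<Rightarrow> real" where
  "Gam w f g x = 1 / (2 * deg w x) * (\<Sum>y\<in>nbrs w x. w x y * (f y - f x) * (g y - g x))"

definition Gam2 :: "('v \<Rightarrow> 'v \<Rightarrow> real) \<Rightarrow> ('v \<Rightarrow> real) \<Rightarrow> 'v \<Rightarrow> real" where
  "Gam2 w f x = (lap w (Gam w f f) x - 2 * Gam w f (lap w f) x) / 2"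

definition Gam2_tilde :: "('v \<Rightarrow> 'v \<Rightarrow> real) \<Rightarrow> ('v \<Rightarrow> real) \<Rightarrow> 'v \<Rightarrow> real" where
  "Gam2_tilde w f x = Gam2 w f x - Gam w f (\<lambda>y. Gam w f f y / f y) x"

definition CDE' :: "('v \<Rightarrow> 'v \<Rightarrow> real) \<Rightarrow> real \<Rightarrow> real \<Rightarrow> bool" where
  "CDE' w n K \<longleftrightarrow>
     (\<forall>x f. (\<forall>y. f y > 0) \<longrightarrow>
        Gam2_tilde w f x \<ge>
          1 / n * (f x)\<^sup>2 * (lap w (\<lambda>y. ln (f y)) x)\<^sup>2 + K * Gam w f f x)"

definition Delta_cond :: "('v \<Rightarrow> 'v \<Rightarrow> real) \<Rightarrow> real \<Rightarrow> bool" where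
  "Delta_cond w \<alpha> \<longleftrightarrow>
     (\<forall>x. x \<in> nbrs w x) \<and> (\<forall>x. \<forall>y\<in>nbrs w x. w x y \<ge> \<alpha> * deg w x)"

definition eigen1 :: "('v \<Rightarrow> 'v \<Rightarrow> real) \<Rightarrow> 'v set \<Rightarrow> real" where
  "eigen1 w \<Omega> =
     Inf {integ w (Gam w f f) / (lpnorm w 2 f)\<^sup>2 | f. f \<noteq> (\<lambda>_. 0) \<and> supp f \<subseteq> \<Omega>}"

primrec dheat :: "('v \<Rightarrow> 'v \<Rightarrow> real) \<Rightarrow> nat \<Rightarrow> 'v \<Rightarrow> 'v \<Rightarrow> real" where
  "dheat w 0 x z = (if x = z then 1 else 0)"
| "dheat w (Suc k) x z = (\<Sum>y\<in>nbrs w x. w x y / deg w x * dheat w k y z)"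

text \<open>The exponential series of the bounded operator \<open>t\<Delta>\<close> on \<open>l2 w\<close>, evaluated at a vertex.
  For \<open>f \<in> l2 w\<close> it converges in norm, hence pointwise because all degrees are positive.\<close>

definition heat_semigroup :: "('v \<Rightarrow> 'v \<Rightarrow> real) \<Rightarrow> real \<Rightarrow> ('v \<Rightarrow> real) \<Rightarrow> 'v \<Rightarrow> real" where
  "heat_semigroup w t f x = (\<Sum>k. t ^ k / fact k * (lap w ^^ k) f x)"

text \<open>The integral kernel of the semigroup with respect to the degree measure. It exists, and
  it is unique as one sees from point masses \<open>f\<close>.\<close>

definition heat_kernel :: "('v \<Rightarrow> 'v \<Rightarrow> real) \<Rightarrow> real \<Rightarrow> 'v \<Rightarrow> 'v \<Rightarrow> real" where
  "heat_kernel w t =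
     (THE q. \<forall>f\<in>l2 w. \<forall>x.
        ((\<lambda>y. deg w y * q x y * f y) has_sum heat_semigroup w t f x) UNIV)"

end

theory Submission
  imports Defs
begin

text \<open>Along a solution \<open>u > 0\<close> of the heat equation, \<open>CDE'(n,0)\<close> makes
  \<open>t\<^sup>2 \<Gamma>(\<surd>u) - t\<^sup>2/2 \<Delta>u - n/2 t u\<close> a subsolution, and the maximum principle for bounded functions
  gives the Li--Yau inequality \<open>\<Gamma>(\<surd>u) \<le> \<Delta>u/2 + n/(2t) u\<close>.  Applied to \<open>u + M\<close> and \<open>2M - u\<close> for
  \<open>0 \<le> u \<le> M\<close> it bounds the differences of \<open>u\<close> along edges by \<open>const M / \<surd>t\<close>.  Since the heat
  kernel has mass at most \<open>1\<close>, this and the volume growth yield \<open>p(t,x,y) \<le> C t\<^bsup>-D/2\<^esup>\<close> by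
  doubling \<open>t\<close>; no Harnack inequality is used.  From \<open>\<parallel>f\<parallel>\<^sub>2\<^sup>2 \<le> t \<langle>\<Gamma>(f)\<rangle> + \<langle>f, P\<^sub>t f\<rangle>\<close> one gets
  the Nash and Faber--Krahn inequalities, from the latter the Sobolev inequality by dyadic
  truncation, and from this the logarithmic Sobolev inequality by Jensen.  The discrete-time
  bound is read off from the Poisson mixture that defines the heat kernel.\<close>

text \<open>Li--Yau controls Gamma(sqrt u) only up to the term Delta u / 2, for which an upper bound
  is still missing. The second solution 2M - u supplies it: its Laplacian is -Delta u, and its
  gradient form is nonnegative. Both shifted functions take values in [M, 2M], so they are uniformly
  positive, as Li--Yau requires, and the square roots can be undone afterwards; the condition
  Delta(alpha) then isolates a single edge.

  The Laplacian is P - 1, where P averages over neighbours, so the heat flow is a Poisson mixture of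
  the powers of P. Statements about the flow are therefore proved for each power and summed: the
  lower bound for the pairing of f with its heat flow comes from the same bound for P^k with loss k
  times the energy, since the Poisson mean of k is t.

  Volume growth at small radius bounds the degrees from below. Hence square summable functions are
  bounded, and the semigroup on them can be studied through bounded solutions of the heat
  equation.\<close>

definition avg :: "('v \<Rightarrow> 'v \<Rightarrow> real) \<Rightarrow> ('v \<Rightarrow> real) \<Rightarrow> 'v \<Rightarrow> real" where
  "avg w f x = (\<Sum>y\<in>nbrs w x. w x y * f y) / deg w x"

section \<open>The averaging operator, the Laplacian and the gradient form\<close>

locale wgraph =
  fixes w :: "'v \<Rightarrow> 'v \<Rightarrow> real"
  assumes weighted_graph: "weighted_graph w"
begin

lemma weight_nonneg: "w x y \<ge> 0"
  and weight_sym: "w x y = w y x"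
  and finite_nbrs: "finite (nbrs w x)"
  and deg_pos: "deg w x > 0"
  using weighted_graph by (auto simp: weighted_graph_def)

lemma deg_nonzero [simp]: "deg w x \<noteq> 0"
  using deg_pos[of x] by simp

lemma deg_nonneg: "deg w x \<ge> 0"
  using deg_pos[of x] by simp

lemma weight_eq_0: "y \<notin> nbrs w x \<Longrightarrow> w x y = 0"
  using weight_nonneg[of x y] by (auto simp: nbrs_def)

lemma nbrs_sym: "y \<in> nbrs w x \<longleftrightarrow> x \<in> nbrs w y"
  by (simp add: nbrs_def weight_sym[of x y])

lemma avg_add: "avg w (\<lambda>y. f y + g y) x = avg w f x + avg w g x"
  by (simp add: avg_def sum.distrib distrib_left add_divide_distrib)

lemma avg_diff: "avg w (\<lambda>y. f y - g y) x = avg w f x - avg w g x"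
  by (simp add: avg_def sum_subtractf right_diff_distrib diff_divide_distrib)

lemma avg_cmult: "avg w (\<lambda>y. c * f y) x = c * avg w f x"
  by (simp add: avg_def sum_distrib_left mult.left_commute)

lemma avg_const [simp]: "avg w (\<lambda>y. c) x = c"
  by (simp add: avg_def flip: sum_distrib_right deg_def)

lemma avg_mono:
  assumes "\<And>y. y \<in> nbrs w x \<Longrightarrow> f y \<le> g y"
  shows "avg w f x \<le> avg w g x"
  unfolding avg_def
  using assms deg_nonneg weight_nonneg by (intro divide_right_mono sum_mono mult_left_mono) auto

lemma abs_avg_le: "\<bar>avg w f x\<bar> \<le> avg w (\<lambda>y. \<bar>f y\<bar>) x"
proof -
  have "avg w f x \<le> avg w (\<lambda>y. \<bar>f y\<bar>) x" "avg w (\<lambda>y. - 1 * f y) x \<le> avg w (\<lambda>y. \<bar>f y\<bar>) x"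
    by (rule avg_mono; simp)+
  then show ?thesis
    unfolding avg_cmult by simp
qed

lemma avg_abs_le_const:
  assumes "\<And>y. \<bar>f y\<bar> \<le> M"
  shows "\<bar>avg w f x\<bar> \<le> M"
  using abs_avg_le[of f x] avg_mono[of x "\<lambda>y. \<bar>f y\<bar>" "\<lambda>_. M"] assms by auto

lemma lap_eq_avg: "lap w f x = avg w f x - f x"
  by (simp add: lap_def avg_def right_diff_distrib sum_subtractf diff_divide_distrib
      flip: sum_distrib_right deg_def)

lemma Gam_eq_avg: "Gam w f g x = avg w (\<lambda>y. (f y - f x) * (g y - g x)) x / 2"
  by (simp add: Gam_def avg_def mult.assoc)

lemma lap_add: "lap w (\<lambda>y. f y + g y) x = lap w f x + lap w g x"
  and lap_diff: "lap w (\<lambda>y. f y - g y) x = lap w f x - lap w g x"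
  and lap_cmult: "lap w (\<lambda>y. c * f y) x = c * lap w f x"
  by (simp_all add: lap_eq_avg avg_add avg_diff avg_cmult right_diff_distrib)

lemma Gam_nonneg: "Gam w f f x \<ge> 0"
  unfolding Gam_eq_avg using avg_mono[of x "\<lambda>_. 0" "\<lambda>y. (f y - f x) * (f y - f x)"] by auto

lemma Gam_add_right: "Gam w f (\<lambda>y. g y + h y) x = Gam w f g x + Gam w f h x"
proof -
  have "avg w (\<lambda>y. (f y - f x) * (g y + h y - (g x + h x))) x =
      avg w (\<lambda>y. (f y - f x) * (g y - g x) + (f y - f x) * (h y - h x)) x"
    by (simp add: algebra_simps)
  then show ?thesis
    unfolding Gam_eq_avg avg_add by simp
qed

lemma Gam_alt: "Gam w f f x = (lap w (\<lambda>y. (f y)\<^sup>2) x - 2 * f x * lap w f x) / 2"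
proof -
  have "avg w (\<lambda>y. (f y - f x) * (f y - f x)) x =
      avg w (\<lambda>y. ((f y)\<^sup>2 - (2 * f x) * f y) + (f x)\<^sup>2) x"
    by (simp add: power2_eq_square algebra_simps)
  also have "\<dots> = avg w (\<lambda>y. (f y)\<^sup>2) x - 2 * f x * avg w f x + (f x)\<^sup>2"
    by (simp only: avg_add avg_diff avg_cmult avg_const)
  finally show ?thesis
    by (simp add: Gam_eq_avg lap_eq_avg power2_eq_square algebra_simps)
qed

lemma abs_lap_le:
  assumes "\<And>y. \<bar>f y\<bar> \<le> M"
  shows "\<bar>lap w f x\<bar> \<le> 2 * M"
  using avg_abs_le_const[of f M x, OF assms] assms[of x] by (auto simp: lap_eq_avg)

lemma Gam_le:
  assumes "\<And>y. \<bar>f y\<bar> \<le> M"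
  shows "Gam w f f x \<le> 2 * M\<^sup>2"
proof -
  have "(f y - f x) * (f y - f x) \<le> (2 * M)\<^sup>2" for y
  proof -
    have "\<bar>f y - f x\<bar> \<le> \<bar>2 * M\<bar>"
      using assms[of x] assms[of y] by linarith
    then have "(f y - f x)\<^sup>2 \<le> (2 * M)\<^sup>2"
      by (simp only: abs_le_square_iff)
    then show ?thesis
      by (simp only: power2_eq_square)
  qed
  then have "avg w (\<lambda>y. (f y - f x) * (f y - f x)) x \<le> (2 * M)\<^sup>2"
    using avg_mono[of x _ "\<lambda>_. (2 * M)\<^sup>2"] by fastforce
  then show ?thesis
    by (simp add: Gam_eq_avg)
qed

section \<open>The maximum principle and the Li--Yau estimate\<close>

text \<open>On an infinite graph a bounded function need not attain its supremum, so the bound is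
  improved step by step. Since \<open>lap w\<close> is averaging minus the identity, the derivative
  of \<open>exp t * W t x\<close> is at most the average of \<open>exp t * W t\<close> over the
  neighbours. Integrating in time turns the bound \<open>K' * t ^ k / fact k\<close> into the one
  for \<open>Suc k\<close>, and these bounds tend to 0.\<close>

lemma max_principle:
  assumes der: "\<And>t x. 0 \<le> t \<Longrightarrow> t \<le> T \<Longrightarrow> ((\<lambda>s. W s x) has_real_derivative W' t x) (at t)"
    and le: "\<And>t x. 0 \<le> t \<Longrightarrow> t \<le> T \<Longrightarrow> W' t x \<le> lap w (W t) x"
    and bdd: "\<And>t x. 0 \<le> t \<Longrightarrow> t \<le> T \<Longrightarrow> W t x \<le> K"
    and init: "\<And>x. W 0 x \<le> 0"
    and t: "0 \<le> t" "t \<le> T"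
  shows "W t x \<le> 0"
proof -
  define K' where "K' = \<bar>K\<bar> * exp T"
  have iter: "exp t * W t x \<le> K' * t ^ k / fact k" if "0 \<le> t" "t \<le> T" for k t x
    using that
  proof (induction k arbitrary: t x)
    case 0
    have "exp t * W t x \<le> exp T * \<bar>K\<bar>"
      using bdd[OF 0, of x] 0
      by (intro order.trans[OF mult_left_mono[of "W t x" "\<bar>K\<bar>"] mult_right_mono]) auto
    then show ?case by (simp add: K'_def mult.commute)
  next
    case (Suc k)
    define h where "h s = exp s * W s x - K' * s ^ Suc k / fact (Suc k)" for s
    have "h t \<le> h 0"
    proof (rule DERIV_nonpos_imp_nonincreasing[where f = h])
      fix s assume s: "0 \<le> s" "s \<le> t"
      then have s': "0 \<le> s" "s \<le> T" using Suc.prems by auto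
      have "((\<lambda>s. s ^ Suc k) has_real_derivative real (Suc k) * s ^ k) (at s)"
        using DERIV_pow[of "Suc k" s] by simp
      from DERIV_cmult[OF this, of "K' / fact (Suc k)"]
      have dp: "((\<lambda>s. K' * s ^ Suc k / fact (Suc k)) has_real_derivative K' * s ^ k / fact k) (at s)"
        by (simp add: fact_Suc del: of_nat_Suc power_Suc)
      have "(h has_real_derivative
          (exp s * W s x + exp s * W' s x - K' * s ^ k / fact k)) (at s)"
        unfolding h_def
        by (rule DERIV_diff[OF DERIV_mult[OF DERIV_exp der[OF s']] dp, THEN DERIV_cong]) simp
      moreover have "exp s * W s x + exp s * W' s x \<le> K' * s ^ k / fact k"
      proof -
        have "exp s * W s x + exp s * W' s x \<le> exp s * avg w (W s) x"
          using le[OF s', of x] by (simp add: lap_eq_avg flip: distrib_left)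
        also have "\<dots> = avg w (\<lambda>y. exp s * W s y) x"
          by (simp add: avg_cmult)
        also have "\<dots> \<le> K' * s ^ k / fact k"
          using avg_mono[of x "\<lambda>y. exp s * W s y" "\<lambda>_. K' * s ^ k / fact k"] Suc.IH[OF s'] by simp
        finally show ?thesis .
      qed
      ultimately show "\<exists>y. (h has_real_derivative y) (at s) \<and> y \<le> 0"
        by (intro exI[of _ "exp s * W s x + exp s * W' s x - K' * s ^ k / fact k"] conjI) auto
    qed (use Suc in auto)
    also have "h 0 \<le> 0"
      using init by (simp add: h_def)
    finally show ?case by (simp add: h_def)
  qed
  have "(\<lambda>k. K' * (t ^ k / fact k)) \<longlonglongrightarrow> K' * 0"
    using summable_LIMSEQ_zero[OF summable_exp[of t]]
    by (intro tendsto_mult tendsto_const) (simp add: divide_inverse mult.commute)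
  then have "exp t * W t x \<le> 0"
    using iter[OF t, of x] by (intro LIMSEQ_le_const) auto
  then show ?thesis
    by (simp add: mult_le_0_iff)
qed

definition heat_eq :: "(real \<Rightarrow> 'v \<Rightarrow> real) \<Rightarrow> bool" where
  "heat_eq u \<longleftrightarrow> (\<forall>t\<ge>0. \<forall>x. ((\<lambda>s. u s x) has_real_derivative lap w (u t) x) (at t))"

lemma heat_eqD:
  "heat_eq u \<Longrightarrow> 0 \<le> t \<Longrightarrow> ((\<lambda>s. u s x) has_real_derivative lap w (u t) x) (at t)"
  by (simp add: heat_eq_def)

lemma heat_eq_le:
  assumes u: "heat_eq u" and bdd: "\<And>t x. 0 \<le> t \<Longrightarrow> t \<le> T \<Longrightarrow> u t x \<le> K"
    and init: "\<And>x. u 0 x \<le> b" and t: "0 \<le> t" "t \<le> T"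
  shows "u t x \<le> b"
proof -
  have "u t x - b \<le> 0"
  proof (rule max_principle[where W = "\<lambda>t x. u t x - b" and K = "K - b" and T = T])
    show "((\<lambda>s. u s x - b) has_real_derivative lap w (u t) x) (at t)" if "0 \<le> t" for t x
      using heat_eqD[OF u that] by (auto intro!: derivative_eq_intros)
    show "lap w (u t) x \<le> lap w (\<lambda>x. u t x - b) x" for t x
      by (simp add: lap_eq_avg avg_diff)
  qed (use assms in auto)
  then show ?thesis by simp
qed

lemma lap_has_derivative:
  assumes "\<And>y. ((\<lambda>s. g s y) has_real_derivative g' y) (at t)"
  shows "((\<lambda>s. lap w (g s) x) has_real_derivative lap w g' x) (at t)"
  unfolding lap_def
  by (auto intro!: derivative_eq_intros assms sum.cong simp: mult.commute)

lemma Gam_has_derivative: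
  assumes "\<And>y. ((\<lambda>s. g s y) has_real_derivative g' y) (at t)"
  shows "((\<lambda>s. Gam w (g s) (g s) x) has_real_derivative 2 * Gam w (g t) g' x) (at t)"
proof -
  have "((\<lambda>s. \<Sum>y\<in>nbrs w x. w x y * (g s y - g s x) * (g s y - g s x)) has_real_derivative
      (\<Sum>y\<in>nbrs w x. 2 * (w x y * (g t y - g t x) * (g' y - g' x)))) (at t)"
    by (intro DERIV_sum) (auto intro!: derivative_eq_intros assms simp: algebra_simps)
  from DERIV_cmult[OF this, of "1 / (2 * deg w x)"] show ?thesis
    by (simp add: Gam_def flip: sum_distrib_left)
qed

text \<open>Concavity of the logarithm: the one-sided form in which the chain rule for
  \<open>ln\<close> survives on a graph.\<close>

lemma lap_ln_le:
  assumes "\<And>y. f y > 0"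
  shows "lap w (\<lambda>y. ln (f y)) x \<le> lap w f x / f x"
proof -
  have "ln (f y) - ln (f x) \<le> 1 / f x * f y - 1" for y
    using ln_le_minus_one[of "f y / f x"] assms[of x] assms[of y] by (simp add: ln_div)
  then have "avg w (\<lambda>y. ln (f y) - ln (f x)) x \<le> avg w (\<lambda>y. 1 / f x * f y - 1) x"
    by (intro avg_mono)
  then show ?thesis
    using assms[of x] unfolding avg_diff avg_cmult avg_const
    by (simp add: lap_eq_avg diff_divide_distrib)
qed

text \<open>The modified iterated form is what \<open>(\<Delta> - \<partial>\<^sub>t) \<Gamma>(\<surd>u)\<close> amounts to along a
  positive solution \<open>u\<close>.\<close>

lemma Gam2_tilde_alt:
  assumes "\<And>y. f y > 0"
  shows "2 * Gam2_tilde w f x =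
    lap w (Gam w f f) x - 2 * Gam w f (\<lambda>y. lap w (\<lambda>z. (f z)\<^sup>2) y / (2 * f y)) x"
proof -
  have "(\<lambda>y. lap w (\<lambda>z. (f z)\<^sup>2) y / (2 * f y)) = (\<lambda>y. lap w f y + Gam w f f y / f y)"
  proof
    fix y
    show "lap w (\<lambda>z. (f z)\<^sup>2) y / (2 * f y) = lap w f y + Gam w f f y / f y"
      using assms[of y] by (simp add: Gam_alt field_simps)
  qed
  then show ?thesis
    by (simp add: Gam2_tilde_def Gam2_def Gam_add_right)
qed

text \<open>The maximum principle is applied to the difference of the two sides times
  \<open>t\<^sup>2\<close>, a factor that makes it vanish at time 0. The lower bound
  \<open>\<delta>\<close> makes \<open>u\<close> positive, so that its square root is differentiable
  in time.\<close>

lemma li_yau: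
  assumes CDE: "CDE' w n 0" and n: "n > 0" and u: "heat_eq u" and \<delta>: "\<delta> > 0"
    and lower: "\<And>t x. 0 \<le> t \<Longrightarrow> \<delta> \<le> u t x"
    and upper: "\<And>t x. 0 \<le> t \<Longrightarrow> u t x \<le> M"
    and t: "t > 0"
  shows "Gam w (\<lambda>y. sqrt (u t y)) (\<lambda>y. sqrt (u t y)) x \<le> lap w (u t) x / 2 + n / (2 * t) * u t x"
proof -
  define f where "f t y = sqrt (u t y)" for t y
  define W where
    "W t x = t\<^sup>2 * Gam w (f t) (f t) x - t\<^sup>2 / 2 * lap w (u t) x - n / 2 * t * u t x" for t x
  define G' where "G' t x = 2 * Gam w (f t) (\<lambda>y. lap w (u t) y / (2 * f t y)) x" for t x
  define W' where
    "W' t x = 2 * t * Gam w (f t) (f t) x + t\<^sup>2 * G' t x - t * lap w (u t) x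
       - t\<^sup>2 / 2 * lap w (lap w (u t)) x - n / 2 * u t x - n / 2 * t * lap w (u t) x" for t x
  have u_pos: "u t x > 0" if "0 \<le> t" for t x
    using lower[OF that, of x] \<delta> by linarith
  have f_pos: "f t x > 0" if "0 \<le> t" for t x
    using u_pos[OF that] by (simp add: f_def)
  have f_sq: "(f t y)\<^sup>2 = u t y" if "0 \<le> t" for t y
    using u_pos[OF that, of y] by (simp add: f_def)
  have "W t x \<le> 0"
  proof (rule max_principle[where W = W and W' = W' and T = t and K = "t\<^sup>2 * (2 * M) + t\<^sup>2 * M"])
    fix s x assume s: "0 \<le> s" "s \<le> t"
    have df: "((\<lambda>s. f s y) has_real_derivative lap w (u s) y / (2 * f s y)) (at s)" for y
      unfolding f_def using u_pos[OF s(1), of y]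
      by (auto intro!: derivative_eq_intros heat_eqD[OF u s(1)] simp: field_simps)
    have dG: "((\<lambda>s. Gam w (f s) (f s) x) has_real_derivative G' s x) (at s)"
      unfolding G'_def by (rule Gam_has_derivative) (rule df)
    have dL: "((\<lambda>s. lap w (u s) x) has_real_derivative lap w (lap w (u s)) x) (at s)"
      by (rule lap_has_derivative) (rule heat_eqD[OF u s(1)])
    show "((\<lambda>s. W s x) has_real_derivative W' s x) (at s)"
      unfolding W_def W'_def
      by (auto intro!: derivative_eq_intros dG dL heat_eqD[OF u s(1)] simp: field_simps)
    have lapW: "lap w (W s) x = s\<^sup>2 * lap w (Gam w (f s) (f s)) x
        - s\<^sup>2 / 2 * lap w (lap w (u s)) x - n / 2 * s * lap w (u s) x"
      unfolding W_def by (simp only: lap_diff lap_cmult)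
    define L where "L = lap w (\<lambda>y. ln (f s y)) x"
    have "2 * Gam2_tilde w (f s) x = lap w (Gam w (f s) (f s)) x - G' s x"
      using Gam2_tilde_alt[of "f s" x] f_pos[OF s(1)] by (simp add: G'_def f_sq[OF s(1)])
    moreover have "Gam2_tilde w (f s) x \<ge> 1 / n * (f s x)\<^sup>2 * L\<^sup>2"
      using CDE f_pos[OF s(1)] unfolding CDE'_def L_def by fastforce
    ultimately have 1: "lap w (Gam w (f s) (f s)) x - G' s x \<ge> 2 / n * u s x * L\<^sup>2"
      by (simp add: f_sq[OF s(1)])
    have "L \<le> lap w (f s) x / f s x"
      unfolding L_def by (rule lap_ln_le) (rule f_pos[OF s(1)])
    then have "(f s x)\<^sup>2 * L \<le> f s x * lap w (f s) x"
      using f_pos[OF s(1), of x] by (simp add: field_simps power2_eq_square)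
    then have 2: "u s x * L \<le> lap w (u s) x / 2 - Gam w (f s) (f s) x"
      by (simp add: Gam_alt[of "f s"] f_sq[OF s(1)] field_simps)
    \<comment> \<open>Completing the square in \<open>L\<close>: the quadratic term comes from the
      curvature condition, the linear one from concavity of the logarithm, and the constant one from
      differentiating the factor \<open>t\<close> in the summand \<open>n / 2 * t * u t x\<close> of
      \<open>W\<close>. The argument covers both signs of \<open>L\<close>.\<close>
    have "0 \<le> u s x * (2 / n) * (s * L + n / 2)\<^sup>2"
      using u_pos[OF s(1), of x] n by simp
    also have "\<dots> = s\<^sup>2 * (2 / n * u s x * L\<^sup>2) + 2 * s * (u s x * L) + n / 2 * u s x"
      using n by (simp add: field_simps power2_eq_square)
    also have "\<dots> \<le> s\<^sup>2 * (lap w (Gam w (f s) (f s)) x - G' s x) +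
        2 * s * (lap w (u s) x / 2 - Gam w (f s) (f s) x) + n / 2 * u s x"
      using mult_left_mono[OF 1, of "s\<^sup>2"] mult_left_mono[OF 2, of "2 * s"] s by simp
    finally show "W' s x \<le> lap w (W s) x"
      unfolding lapW W'_def by (simp add: algebra_simps)
  next
    fix s x assume s: "0 \<le> s" "s \<le> t"
    have M: "M > 0"
      using upper[of 0 x] u_pos[of 0 x] by simp
    have "\<bar>f s y\<bar> \<le> sqrt M" for y
      using upper[OF s(1), of y] u_pos[OF s(1), of y] by (simp add: f_def)
    then have "Gam w (f s) (f s) x \<le> 2 * (sqrt M)\<^sup>2"
      by (rule Gam_le)
    then have 1: "s\<^sup>2 * Gam w (f s) (f s) x \<le> t\<^sup>2 * (2 * M)"
      using s M by (intro mult_mono) (auto intro!: power_mono Gam_nonneg)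
    have "\<bar>lap w (u s) x\<bar> \<le> 2 * M"
      using upper[OF s(1)] u_pos[OF s(1)] by (intro abs_lap_le) (simp add: less_imp_le)
    then have 2: "s\<^sup>2 / 2 * (- lap w (u s) x) \<le> t\<^sup>2 / 2 * (2 * M)"
      using s M by (intro order.trans[OF mult_left_mono mult_right_mono]) (auto intro!: power_mono)
    have 3: "0 \<le> n / 2 * s * u s x"
      using n s u_pos[OF s(1), of x] by simp
    show "W s x \<le> t\<^sup>2 * (2 * M) + t\<^sup>2 * M"
      using 1 2 3 by (simp add: W_def algebra_simps)
  next
    show "W 0 x \<le> 0" for x
      by (simp add: W_def)
  qed (use t in auto)
  moreover have "t\<^sup>2 * (n / (2 * t) * u t x) = n / 2 * t * u t x"
    using t by (simp add: field_simps power2_eq_square)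
  ultimately have "t\<^sup>2 * Gam w (f t) (f t) x \<le> t\<^sup>2 * (lap w (u t) x / 2 + n / (2 * t) * u t x)"
    unfolding W_def distrib_left by linarith
  then show ?thesis
    using t by (simp add: f_def[abs_def])
qed

lemma heat_gradient_bound:
  assumes CDE: "CDE' w n 0" and n: "n > 0" and \<Delta>: "Delta_cond w \<alpha>" and \<alpha>: "\<alpha> > 0"
    and u: "heat_eq u"
    and lower: "\<And>t x. 0 \<le> t \<Longrightarrow> 0 \<le> u t x"
    and upper: "\<And>t x. 0 \<le> t \<Longrightarrow> u t x \<le> M"
    and t: "t > 0" and y: "y \<in> nbrs w x" and M: "M > 0"
  shows "\<bar>u t y - u t x\<bar> \<le> M * sqrt (32 * n / \<alpha>) / sqrt t"
proof -
  define h where "h t x = u t x + M" for t x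
  have lap_h: "lap w (h t) x = lap w (u t) x" for t x
    by (simp add: h_def[abs_def] lap_add) (simp add: lap_def)
  have lap_h': "lap w (\<lambda>x. 2 * M - u t x) x = - lap w (u t) x" for t x
    by (simp add: lap_diff) (simp add: lap_def)
  have "heat_eq h"
    unfolding heat_eq_def lap_h
    by (auto simp: h_def intro!: derivative_eq_intros heat_eqD[OF u])
  then have LY: "Gam w (\<lambda>y. sqrt (h t y)) (\<lambda>y. sqrt (h t y)) x
      \<le> lap w (h t) x / 2 + n / (2 * t) * h t x"
    using li_yau[OF CDE n _ M _ _ t, of h "2 * M" x] lower upper by (fastforce simp: h_def)
  \<comment> \<open>From this solution only the nonnegativity of the left-hand side is kept. In the
    sum of the two right-hand sides \<open>u\<close> cancels, which leaves
    \<open>n / (2 * t) * (3 * M)\<close>.\<close>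
  have "heat_eq (\<lambda>t x. 2 * M - u t x)"
    unfolding heat_eq_def lap_h'
    by (auto intro!: derivative_eq_intros heat_eqD[OF u])
  then have "Gam w (\<lambda>y. sqrt (2 * M - u t y)) (\<lambda>y. sqrt (2 * M - u t y)) x
      \<le> lap w (\<lambda>x. 2 * M - u t x) x / 2 + n / (2 * t) * (2 * M - u t x)"
    using li_yau[OF CDE n _ M _ _ t, of "\<lambda>t x. 2 * M - u t x" "2 * M" x] lower upper
    by fastforce
  then have "lap w (u t) x / 2 \<le> n / (2 * t) * (2 * M - u t x)"
    using Gam_nonneg[of "\<lambda>y. sqrt (2 * M - u t y)" x] unfolding lap_h' by linarith
  then have "Gam w (\<lambda>y. sqrt (h t y)) (\<lambda>y. sqrt (h t y)) x \<le> n / (2 * t) * (3 * M)"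
  proof -
    have "n / (2 * t) * (2 * M - u t x) + n / (2 * t) * h t x = n / (2 * t) * (3 * M)"
      unfolding h_def by (subst distrib_left[symmetric]) simp
    with LY show ?thesis
      using \<open>lap w (u t) x / 2 \<le> _\<close> unfolding lap_h by linarith
  qed
  moreover have "\<alpha> / 2 * (sqrt (h t y) - sqrt (h t x))\<^sup>2
      \<le> Gam w (\<lambda>y. sqrt (h t y)) (\<lambda>y. sqrt (h t y)) x"
  proof -
    have "\<alpha> * deg w x * (sqrt (h t y) - sqrt (h t x))\<^sup>2 \<le> w x y * (sqrt (h t y) - sqrt (h t x))\<^sup>2"
      using \<Delta> y by (intro mult_right_mono) (auto simp: Delta_cond_def)
    also have "\<dots> \<le> (\<Sum>y\<in>nbrs w x. w x y * (sqrt (h t y) - sqrt (h t x))\<^sup>2)"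
      by (intro member_le_sum y finite_nbrs) (simp add: weight_nonneg)
    finally show ?thesis
      unfolding Gam_def using deg_pos[of x] by (simp add: field_simps power2_eq_square)
  qed
  ultimately have "\<alpha> / 2 * (sqrt (h t y) - sqrt (h t x))\<^sup>2 \<le> n / (2 * t) * (3 * M)"
    by linarith
  then have sq: "(sqrt (h t y) - sqrt (h t x))\<^sup>2 \<le> 3 * n * M / (\<alpha> * t)"
    using \<alpha> t by (simp add: field_simps)
  have h_nn: "0 \<le> h t z" "h t z \<le> 2 * M" for z
    using lower[of t z] upper[of t z] t M by (auto simp: h_def)
  \<comment> \<open>A difference of squares leads from the square roots back to \<open>u\<close>.
    The factors 3 and 8 give 24, and the constant 32 of the claim leaves room for that.\<close>
  have "(sqrt (h t y) + sqrt (h t x))\<^sup>2 \<le> (2 * sqrt (2 * M))\<^sup>2"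
    using h_nn[of x] h_nn[of y] M
    by (intro power_mono) (auto intro!: add_nonneg_nonneg add_mono[of _ "sqrt (2 * M)" _ "sqrt (2 * M)", simplified])
  also have "\<dots> = 8 * M"
    using M by (simp add: power_mult_distrib)
  finally have "(sqrt (h t y) + sqrt (h t x))\<^sup>2 \<le> 8 * M" .
  then have "(sqrt (h t y) - sqrt (h t x))\<^sup>2 * (sqrt (h t y) + sqrt (h t x))\<^sup>2
      \<le> 3 * n * M / (\<alpha> * t) * (8 * M)"
    using sq n M \<alpha> t by (intro mult_mono) auto
  moreover have "(sqrt (h t y) - sqrt (h t x)) * (sqrt (h t y) + sqrt (h t x)) = u t y - u t x"
    using h_nn by (simp add: algebra_simps h_def)
  ultimately have "(u t y - u t x)\<^sup>2 \<le> 3 * n * M / (\<alpha> * t) * (8 * M)"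
    by (metis power_mult_distrib)
  also have "\<dots> \<le> (M * sqrt (32 * n / \<alpha>) / sqrt t)\<^sup>2"
    using n \<alpha> t M by (simp add: power_mult_distrib power_divide field_simps power2_eq_square)
  finally show ?thesis
    using n \<alpha> t M by (subst (asm) abs_le_square_iff[symmetric]) simp
qed

end

section \<open>The heat kernel\<close>

lemma exp_series_abs_summable:
  fixes a :: "nat \<Rightarrow> real"
  assumes "\<And>k. \<bar>a k\<bar> \<le> M * R ^ k"
  shows "summable (\<lambda>k. \<bar>t ^ k / fact k * a k\<bar>)"
proof (rule summable_comparison_test')
  show "summable (\<lambda>k. M * ((\<bar>t\<bar> * R) ^ k / fact k))"
    using summable_exp[of "\<bar>t\<bar> * R"]
    by (intro summable_mult) (simp add: divide_inverse mult.commute)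
  fix k :: nat
  have "\<bar>t ^ k / fact k * a k\<bar> = \<bar>t\<bar> ^ k / fact k * \<bar>a k\<bar>"
    by (simp add: abs_mult power_abs)
  also have "\<dots> \<le> \<bar>t\<bar> ^ k / fact k * (M * R ^ k)"
    by (intro mult_left_mono assms) auto
  finally show "norm \<bar>t ^ k / fact k * a k\<bar> \<le> M * ((\<bar>t\<bar> * R) ^ k / fact k)"
    by (simp add: power_mult_distrib mult_ac)
qed

lemma exp_series_summable:
  fixes a :: "nat \<Rightarrow> real"
  assumes "\<And>k. \<bar>a k\<bar> \<le> M * R ^ k"
  shows "summable (\<lambda>k. t ^ k / fact k * a k)"
  using exp_series_abs_summable[OF assms] by (rule summable_rabs_cancel)

lemma exp_sums: "(\<lambda>k. t ^ k / fact k) sums exp (t :: real)"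
  using exp_converges[of t] by (simp add: divide_inverse mult.commute)

lemma exp_series_le:
  fixes a :: "nat \<Rightarrow> real"
  assumes "\<And>k. \<bar>a k\<bar> \<le> M * R ^ k" and "0 \<le> t"
  shows "\<bar>\<Sum>k. t ^ k / fact k * a k\<bar> \<le> M * exp (t * R)"
proof -
  have "\<bar>\<Sum>k. t ^ k / fact k * a k\<bar> \<le> (\<Sum>k. \<bar>t ^ k / fact k * a k\<bar>)"
    by (rule summable_rabs[OF exp_series_abs_summable[OF assms(1)]])
  also have "\<dots> \<le> M * exp (t * R)"
  proof (rule sums_le)
    show "(\<lambda>k. \<bar>t ^ k / fact k * a k\<bar>) sums (\<Sum>k. \<bar>t ^ k / fact k * a k\<bar>)"
      by (rule summable_sums[OF exp_series_abs_summable[OF assms(1)]])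
    show "(\<lambda>k. M * ((t * R) ^ k / fact k)) sums (M * exp (t * R))"
      by (intro sums_mult exp_sums)
    fix k :: nat
    have "\<bar>t ^ k / fact k * a k\<bar> = t ^ k / fact k * \<bar>a k\<bar>"
      using assms(2) by (simp add: abs_mult)
    also have "\<dots> \<le> t ^ k / fact k * (M * R ^ k)"
      using assms by (intro mult_left_mono) auto
    finally show "\<bar>t ^ k / fact k * a k\<bar> \<le> M * ((t * R) ^ k / fact k)"
      by (simp add: power_mult_distrib mult_ac)
  qed
  finally show ?thesis .
qed

lemma exp_series_has_derivative:
  fixes a :: "nat \<Rightarrow> real"
  assumes "\<And>k. \<bar>a k\<bar> \<le> M * R ^ k"
  shows "((\<lambda>t. \<Sum>k. t ^ k / fact k * a k) has_real_derivative
    (\<Sum>k. t ^ k / fact k * a (Suc k))) (at t)"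
proof -
  have "summable (\<lambda>k. a k / fact k * y ^ k)" for y
    using exp_series_summable[OF assms, of y] by (simp add: mult_ac)
  from termdiffs_strong_converges_everywhere[OF this, of t]
  have "((\<lambda>t. \<Sum>k. a k / fact k * t ^ k) has_real_derivative
      (\<Sum>k. diffs (\<lambda>k. a k / fact k) k * t ^ k)) (at t)" .
  moreover have "diffs (\<lambda>k. a k / fact k) k = a (Suc k) / fact k" for k
    by (simp add: diffs_def fact_Suc del: of_nat_Suc)
  ultimately show ?thesis
    by (simp add: mult_ac)
qed

section \<open>The semigroup on bounded functions as a Poisson mixture\<close>

context wgraph
begin

text \<open>The exponential of \<open>t\<close> times the Laplacian with the factor
  \<open>exp (- t)\<close> split off. For \<open>0 \<le> t\<close> the remaining coefficients are
  nonnegative, so positivity and contraction in the supremum norm can be read off.\<close>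

definition heat_ser :: "('v \<Rightarrow> real) \<Rightarrow> real \<Rightarrow> 'v \<Rightarrow> real" where
  "heat_ser f t x = exp (- t) * (\<Sum>k. t ^ k / fact k * (avg w ^^ k) f x)"

lemma abs_avg_pow_le:
  assumes "\<And>x. \<bar>f x\<bar> \<le> M"
  shows "\<bar>(avg w ^^ k) f x\<bar> \<le> M"
  by (induction k arbitrary: x) (use assms in \<open>auto intro: avg_abs_le_const\<close>)

lemma avg_pow_bound:
  assumes "\<And>x. \<bar>f x\<bar> \<le> M"
  shows "\<bar>(avg w ^^ k) f x\<bar> \<le> M * 1 ^ k"
  using abs_avg_pow_le[OF assms] by simp

lemma abs_lap_pow_le:
  assumes "\<And>x. \<bar>f x\<bar> \<le> M"
  shows "\<bar>(lap w ^^ k) f x\<bar> \<le> M * 2 ^ k"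
proof (induction k arbitrary: x)
  case (Suc k)
  show ?case
    using abs_lap_le[of "(lap w ^^ k) f" "M * 2 ^ k" x] Suc by (simp add: mult.left_commute)
qed (use assms in simp)

lemma avg_suminf:
  assumes "\<And>y. summable (\<lambda>k. g k y)"
  shows "avg w (\<lambda>y. \<Sum>k. g k y) x = (\<Sum>k. avg w (g k) x)"
  unfolding avg_def using assms
  by (simp add: suminf_mult[symmetric] suminf_sum[symmetric] suminf_divide summable_sum summable_mult)

lemma heat_eq_heat_ser:
  assumes "\<And>x. \<bar>f x\<bar> \<le> M"
  shows "heat_eq (heat_ser f)"
  unfolding heat_eq_def
proof (intro allI impI)
  fix t :: real and x
  have "avg w (\<lambda>y. \<Sum>k. t ^ k / fact k * (avg w ^^ k) f y) x =
      (\<Sum>k. t ^ k / fact k * (avg w ^^ Suc k) f x)"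
    using avg_suminf[of "\<lambda>k y. t ^ k / fact k * (avg w ^^ k) f y" x,
        OF exp_series_summable[OF avg_pow_bound[OF assms]]]
    unfolding avg_cmult by simp
  then have "avg w (heat_ser f t) x = exp (- t) * (\<Sum>k. t ^ k / fact k * (avg w ^^ Suc k) f x)"
    unfolding heat_ser_def avg_cmult by simp
  moreover have d: "((\<lambda>s. exp (- s)) has_real_derivative - exp (- t)) (at t)"
    by (auto intro!: derivative_eq_intros)
  have "((\<lambda>s. \<Sum>k. s ^ k / fact k * (avg w ^^ k) f x) has_real_derivative
      (\<Sum>k. t ^ k / fact k * (avg w ^^ Suc k) f x)) (at t)"
    by (rule exp_series_has_derivative[OF avg_pow_bound[OF assms]])
  from DERIV_mult[OF d this]
  have "((\<lambda>s. heat_ser f s x) has_real_derivative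
      exp (- t) * (\<Sum>k. t ^ k / fact k * (avg w ^^ Suc k) f x) - heat_ser f t x) (at t)"
    unfolding heat_ser_def[of _ _ x] by (rule DERIV_cong) simp
  ultimately show "((\<lambda>s. heat_ser f s x) has_real_derivative lap w (heat_ser f t) x) (at t)"
    by (simp add: lap_eq_avg)
qed

lemma heat_ser_0: "heat_ser f 0 x = f x"
  using powser_zero[of "\<lambda>k. (avg w ^^ k) f x / fact k"] by (simp add: heat_ser_def mult.commute)

lemma abs_heat_ser_le:
  assumes "\<And>x. \<bar>f x\<bar> \<le> M" and "0 \<le> t"
  shows "\<bar>heat_ser f t x\<bar> \<le> M"
proof -
  have "\<bar>heat_ser f t x\<bar> \<le> exp (- t) * (M * exp (t * 1))"
    unfolding heat_ser_def abs_mult using exp_series_le[OF avg_pow_bound[of f M, OF assms(1)] assms(2)]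
    by (simp add: mult_left_mono)
  then show ?thesis by (simp add: exp_minus field_simps)
qed

lemma heat_eq_heat_semigroup:
  assumes "\<And>x. \<bar>f x\<bar> \<le> M"
  shows "heat_eq (\<lambda>t. heat_semigroup w t f)"
  unfolding heat_eq_def
proof (intro allI impI)
  fix t :: real and x
  have s: "summable (\<lambda>k. t ^ k / fact k * (lap w ^^ k) f y)" for y
    by (rule exp_series_summable[OF abs_lap_pow_le[OF assms]])
  have "avg w (heat_semigroup w t f) x = (\<Sum>k. t ^ k / fact k * avg w ((lap w ^^ k) f) x)"
    using avg_suminf[of "\<lambda>k y. t ^ k / fact k * (lap w ^^ k) f y" x, OF s]
    unfolding avg_cmult heat_semigroup_def .
  moreover have "summable (\<lambda>k. t ^ k / fact k * avg w ((lap w ^^ k) f) x)"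
    by (intro exp_series_summable[where M = M and R = 2] avg_abs_le_const abs_lap_pow_le assms)
  ultimately have "lap w (heat_semigroup w t f) x = (\<Sum>k. t ^ k / fact k * (lap w ^^ Suc k) f x)"
    using s[of x] by (simp add: lap_eq_avg heat_semigroup_def suminf_diff right_diff_distrib)
  then show "((\<lambda>s. heat_semigroup w s f x) has_real_derivative lap w (heat_semigroup w t f) x) (at t)"
    using exp_series_has_derivative[OF abs_lap_pow_le[OF assms]]
    by (simp only: heat_semigroup_def[of w _ f x])
qed

lemma heat_eq_unique:
  assumes u: "heat_eq u" and v: "heat_eq v"
    and bdd: "\<And>t x. 0 \<le> t \<Longrightarrow> t \<le> T \<Longrightarrow> \<bar>u t x - v t x\<bar> \<le> K"
    and init: "\<And>x. u 0 x = v 0 x" and t: "0 \<le> t" "t \<le> T"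
  shows "u t x = v t x"
proof -
  have "heat_eq (\<lambda>t x. u t x - v t x)" "heat_eq (\<lambda>t x. v t x - u t x)"
    unfolding heat_eq_def lap_diff
    by (auto intro!: derivative_eq_intros heat_eqD u v)
  from heat_eq_le[OF this(1), of T K 0 t x] heat_eq_le[OF this(2), of T K 0 t x]
  show ?thesis
    using bdd init t by (fastforce simp: abs_le_iff)
qed

text \<open>Both series solve the heat equation with the same initial value, and bounded solutions
  are unique. The series in powers of the Laplacian comes with the bound
  \<open>M * exp (s * 2)\<close>, which grows in time; this is why uniqueness is stated on a finite
  time interval.\<close>

lemma heat_semigroup_eq_heat_ser:
  assumes "\<And>x. \<bar>f x\<bar> \<le> M" and "0 \<le> t"
  shows "heat_semigroup w t f x = heat_ser f t x"
proof (rule heat_eq_unique[OF heat_eq_heat_semigroup heat_eq_heat_ser])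
  fix s y assume s: "0 \<le> s" "s \<le> t"
  have "\<bar>heat_semigroup w s f y\<bar> \<le> M * exp (s * 2)"
    unfolding heat_semigroup_def by (intro exp_series_le abs_lap_pow_le assms s)
  also have "\<dots> \<le> M * exp (t * 2)"
    using s assms(1)[of y] by (intro mult_left_mono) auto
  finally show "\<bar>heat_semigroup w s f y - heat_ser f s y\<bar> \<le> M * exp (t * 2) + M"
    using abs_heat_ser_le[of f M s y, OF assms(1) s(1)] by linarith
next
  show "heat_semigroup w 0 f y = heat_ser f 0 y" for y
    using powser_zero[of "\<lambda>k. (lap w ^^ k) f y / fact k"]
    by (simp add: heat_semigroup_def heat_ser_0 mult.commute)
qed (use assms in auto)

section \<open>The discrete-time kernel through powers of averaging, and the kernel density
  \<open>hk\<close>\<close>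

lemma dheat_Suc: "dheat w (Suc k) x z = avg w (\<lambda>y. dheat w k y z) x"
  by (simp add: avg_def sum_divide_distrib)

lemma dheat_eq_avg_pow: "dheat w k x z = (avg w ^^ k) (\<lambda>y. if y = z then 1 else 0) x"
  by (induction k arbitrary: x) (simp_all only: dheat_Suc dheat.simps(1) funpow.simps o_apply id_apply)

lemma dheat_nonneg: "dheat w k x z \<ge> 0"
proof (induction k arbitrary: x)
  case (Suc k)
  then show ?case
    unfolding dheat_Suc using avg_mono[of x "\<lambda>_. 0" "\<lambda>y. dheat w k y z"] by simp
qed simp

lemma dheat_le_1: "dheat w k x z \<le> 1"
proof -
  have "\<bar>if y = z then 1 else 0 :: real\<bar> \<le> 1" for y
    by simp
  then have "\<bar>dheat w k x z\<bar> \<le> 1"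
    unfolding dheat_eq_avg_pow by (rule abs_avg_pow_le)
  then show ?thesis by simp
qed

lemma abs_dheat_le: "\<bar>dheat w k x z\<bar> \<le> 1 * 1 ^ k"
  using dheat_nonneg[of k x z] dheat_le_1[of k x z] by simp

lemma finite_dheat_support: "finite {y. dheat w k x y \<noteq> 0}"
proof (induction k arbitrary: x)
  case 0
  show ?case by (rule finite_subset[of _ "{x}"]) auto
next
  case (Suc k)
  have "{y. dheat w (Suc k) x y \<noteq> 0} \<subseteq> (\<Union>u\<in>nbrs w x. {y. dheat w k u y \<noteq> 0})"
    by (auto simp del: dheat.simps simp: dheat_Suc avg_def dest: sum.not_neutral_contains_not_neutral)
  then show ?case
    by (rule finite_subset) (use Suc finite_nbrs in auto)
qed

lemma dheat_has_sum: "((\<lambda>y. dheat w k x y * f y) has_sum (avg w ^^ k) f x) UNIV"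
proof (induction k arbitrary: x)
  case 0
  show ?case
    by (rule has_sum_finite_neutralI[of "{x}"]) auto
next
  case (Suc k)
  define S where "S = (\<Union>u\<in>nbrs w x. {y. dheat w k u y \<noteq> 0})"
  have S: "finite S"
    unfolding S_def using finite_dheat_support finite_nbrs by blast
  have eq: "(avg w ^^ k) f u = (\<Sum>y\<in>S. dheat w k u y * f y)" if "u \<in> nbrs w x" for u
  proof (rule has_sum_unique[OF Suc])
    show "((\<lambda>y. dheat w k u y * f y) has_sum (\<Sum>y\<in>S. dheat w k u y * f y)) UNIV"
      by (rule has_sum_finite_neutralI[of S]) (use S that in \<open>auto simp: S_def\<close>)
  qed
  show ?case
  proof (rule has_sum_finite_neutralI[of S])
    show "dheat w (Suc k) x y * f y = 0" if "y \<in> UNIV - S" for y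
      using that by (auto simp: S_def)
    have "(avg w ^^ Suc k) f x = (\<Sum>u\<in>nbrs w x. \<Sum>y\<in>S. w x u / deg w x * dheat w k u y * f y)"
      using eq by (simp add: avg_def sum_divide_distrib sum_distrib_left mult.assoc)
    also have "\<dots> = (\<Sum>y\<in>S. \<Sum>u\<in>nbrs w x. w x u / deg w x * dheat w k u y * f y)"
      by (rule sum.swap)
    finally show "(avg w ^^ Suc k) f x = (\<Sum>y\<in>S. dheat w (Suc k) x y * f y)"
      by (simp add: sum_distrib_right)
  qed (use S in auto)
qed

lemma avg_pow_const: "(avg w ^^ k) (\<lambda>_. c) x = c"
proof -
  have "(avg w ^^ k) (\<lambda>_. c) = (\<lambda>_. c)"
    by (induction k) (auto intro: ext)
  then show ?thesis by simp
qed

lemma dheat_has_sum_1: "((\<lambda>y. dheat w k x y) has_sum 1) UNIV"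
  using dheat_has_sum[of k x "\<lambda>_. 1"] by (simp add: avg_pow_const)

lemma dheat_sum_le_1: "finite A \<Longrightarrow> (\<Sum>y\<in>A. dheat w k x y) \<le> 1"
  using has_sum_mono_neutral[OF has_sum_finite dheat_has_sum_1[of k x], of A] dheat_nonneg by auto

lemma dheat_add: "dheat w (j + k) x z = (avg w ^^ j) (\<lambda>y. dheat w k y z) x"
  by (simp add: dheat_eq_avg_pow[abs_def] funpow_add)

text \<open>Reversibility of the random walk. The recursion of \<open>dheat\<close> splits off the
  first step from \<open>x\<close>; for the walk from \<open>y\<close> to \<open>x\<close> it is the
  last step that \<open>dheat_add\<close> splits off, and the two sums then agree term by
  term.\<close>

lemma dheat_sym: "deg w x * dheat w k x y = deg w y * dheat w k y x"
proof (induction k arbitrary: x y)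
  case (Suc k)
  have "((\<lambda>u. dheat w k y u * dheat w 1 u x) has_sum dheat w (Suc k) y x) UNIV"
    using dheat_has_sum[of k y "\<lambda>u. dheat w 1 u x"] dheat_add[of k 1 y x] by simp
  then have "((\<lambda>u. deg w y * (dheat w k y u * dheat w 1 u x)) has_sum
      deg w y * dheat w (Suc k) y x) UNIV"
    by (rule has_sum_cmult_right)
  moreover have "deg w y * (dheat w k y u * dheat w 1 u x) = w x u * dheat w k u y" for u
  proof -
    have "dheat w 1 u x = w u x / deg w u"
      by (auto simp: finite_nbrs weight_eq_0 if_distrib cong: if_cong)
    moreover have "deg w y * dheat w k y u = deg w u * dheat w k u y"
      by (rule Suc)
    ultimately show ?thesis
      by (simp add: weight_sym[of u x] flip: mult.assoc)
  qed
  moreover have "((\<lambda>u. w x u * dheat w k u y) has_sum (\<Sum>u\<in>nbrs w x. w x u * dheat w k u y)) UNIV"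
    by (rule has_sum_finite_neutralI[of "nbrs w x"]) (auto simp: finite_nbrs weight_eq_0)
  moreover have "(\<Sum>u\<in>nbrs w x. w x u * dheat w k u y) = deg w x * dheat w (Suc k) x y"
    by (simp add: sum_distrib_left)
  ultimately show ?case
    using has_sum_unique by fastforce
qed simp

definition hk :: "real \<Rightarrow> 'v \<Rightarrow> 'v \<Rightarrow> real" where
  "hk t x z = heat_ser (\<lambda>y. if y = z then 1 else 0) t x / deg w z"

lemma hk_alt: "hk t x z = exp (- t) * (\<Sum>k. t ^ k / fact k * dheat w k x z) / deg w z"
  by (simp add: hk_def heat_ser_def dheat_eq_avg_pow)

lemma hk_summable: "summable (\<lambda>k. t ^ k / fact k * dheat w k x z)"
  by (rule exp_series_summable[OF abs_dheat_le])

lemma hk_nonneg: "0 \<le> t \<Longrightarrow> hk t x z \<ge> 0"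
  unfolding hk_alt using deg_nonneg
  by (intro divide_nonneg_nonneg mult_nonneg_nonneg suminf_nonneg hk_summable)
     (auto intro: mult_nonneg_nonneg dheat_nonneg)

lemma hk_le: "0 \<le> t \<Longrightarrow> hk t x z \<le> 1 / deg w z"
proof -
  assume "0 \<le> t"
  have "\<bar>if y = z then 1 else 0 :: real\<bar> \<le> 1" for y
    by simp
  then have "\<bar>heat_ser (\<lambda>y. if y = z then 1 else 0) t x\<bar> \<le> 1"
    using \<open>0 \<le> t\<close> by (rule abs_heat_ser_le)
  then show ?thesis
    unfolding hk_def using deg_pos[of z] by (intro divide_right_mono) auto
qed

lemma heat_eq_hk: "heat_eq (\<lambda>t x. hk t x z)"
proof -
  have "heat_eq (heat_ser (\<lambda>y. if y = z then 1 else 0))"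
    by (rule heat_eq_heat_ser[of _ 1]) auto
  then show ?thesis
    unfolding heat_eq_def hk_def lap_eq_avg
    using avg_cmult[of "1 / deg w z"]
    by (auto intro!: derivative_eq_intros simp: diff_divide_distrib)
qed

text \<open>The sum runs over the first argument, in which the kernel solves the heat equation and
  its gradient will be bounded. Reversibility turns it into a sum of probabilities of a walk started
  at \<open>z\<close>.\<close>

lemma hk_sum_le_1:
  assumes "finite A" "0 \<le> t"
  shows "(\<Sum>x\<in>A. deg w x * hk t x z) \<le> 1"
proof -
  have "(\<Sum>x\<in>A. deg w x * hk t x z) =
      exp (- t) * (\<Sum>x\<in>A. \<Sum>k. t ^ k / fact k * (deg w x * dheat w k x z)) / deg w z"
    using suminf_mult[OF hk_summable] by (simp add: hk_alt sum_distrib_left sum_divide_distrib mult_ac)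
  also have "(\<Sum>x\<in>A. \<Sum>k. t ^ k / fact k * (deg w x * dheat w k x z)) =
      (\<Sum>k. \<Sum>x\<in>A. t ^ k / fact k * (deg w x * dheat w k x z))"
    using summable_mult[OF hk_summable]
    by (subst suminf_sum) (auto simp: mult_ac)
  also have "\<dots> = (\<Sum>k. t ^ k / fact k * (deg w z * (\<Sum>x\<in>A. dheat w k z x)))"
    by (simp add: sum_distrib_left dheat_sym[of _ _ z])
  also have "\<dots> \<le> deg w z * exp (t * 1)"
  proof -
    have "\<bar>deg w z * (\<Sum>x\<in>A. dheat w k z x)\<bar> \<le> deg w z * 1 ^ k" for k
      using dheat_sum_le_1[OF assms(1), of k z] deg_nonneg[of z]
      by (simp add: abs_mult sum_nonneg dheat_nonneg mult_left_le)
    from exp_series_le[OF this assms(2)] show ?thesis by linarith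
  qed
  finally show ?thesis
    using deg_pos[of z] by (simp add: exp_minus divide_right_mono field_simps)
qed

text \<open>Exchange of the sums over steps \<open>k\<close> and vertices \<open>y\<close>,
  justified by the dominating family \<open>M * (t ^ k / fact k) * dheat w k x y\<close>, whose sums
  over \<open>y\<close> are known.\<close>

lemma hk_has_sum:
  assumes f: "\<And>x. \<bar>f x\<bar> \<le> M" and t: "0 \<le> t"
  shows "((\<lambda>y. deg w y * hk t x y * f y) has_sum heat_ser f t x) UNIV"
proof -
  define g where "g = (\<lambda>(k, y). t ^ k / fact k * dheat w k x y * f y)"
  have M: "0 \<le> M"
    using f[of x] by linarith
  have "(\<lambda>(k, y). M * (t ^ k / fact k) * dheat w k x y) summable_on (UNIV \<times> UNIV)"
  proof (rule summable_on_SigmaI)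
    show "((\<lambda>y. case (k, y) of (k, y) \<Rightarrow> M * (t ^ k / fact k) * dheat w k x y) has_sum
        M * (t ^ k / fact k)) UNIV" for k :: nat
      using has_sum_cmult_right[OF dheat_has_sum_1[of k x], of "M * (t ^ k / fact k)"] by simp
    show "(\<lambda>k. M * (t ^ k / fact k)) summable_on UNIV"
    proof (rule norm_summable_imp_summable_on)
      show "summable (\<lambda>k. norm (M * (t ^ k / fact k)))"
        using M t summable_mult[OF sums_summable[OF exp_sums[of t]], of M] by simp
    qed
  qed (use M t dheat_nonneg in auto)
  then have sg: "g summable_on (UNIV \<times> UNIV)"
  proof (rule Infinite_Sum.abs_summable_summable[OF Infinite_Sum.abs_summable_on_comparison_test'])
    show "norm (g p) \<le> (case p of (k, y) \<Rightarrow> M * (t ^ k / fact k) * dheat w k x y)" for p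
    proof (cases p)
      case (Pair k y)
      have "\<bar>f y\<bar> * (t ^ k / fact k * dheat w k x y) \<le> M * (t ^ k / fact k * dheat w k x y)"
        using f[of y] t dheat_nonneg[of k x y] by (intro mult_right_mono) auto
      then show ?thesis
        using Pair t dheat_nonneg[of k x y] by (simp add: g_def abs_mult mult_ac)
    qed
  qed
  have "(g has_sum (\<Sum>k. t ^ k / fact k * (avg w ^^ k) f x)) (UNIV \<times> UNIV)"
  proof (rule has_sum_SigmaI[OF _ _ sg])
    show "((\<lambda>y. g (k, y)) has_sum t ^ k / fact k * (avg w ^^ k) f x) UNIV" for k
      using has_sum_cmult_right[OF dheat_has_sum[of k x f], of "t ^ k / fact k"]
      by (simp add: g_def mult.assoc)
    show "((\<lambda>k. t ^ k / fact k * (avg w ^^ k) f x) has_sum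
        (\<Sum>k. t ^ k / fact k * (avg w ^^ k) f x)) UNIV"
      using exp_series_abs_summable[OF avg_pow_bound[OF f]] exp_series_summable[OF avg_pow_bound[OF f]]
      by (intro norm_summable_imp_has_sum summable_sums) (simp_all only: real_norm_def)
  qed
  then have "((\<lambda>(y, k). g (k, y)) has_sum (\<Sum>k. t ^ k / fact k * (avg w ^^ k) f x)) (UNIV \<times> UNIV)"
    by (subst (asm) has_sum_swap) simp
  then have "((\<lambda>y. (\<Sum>k. t ^ k / fact k * dheat w k x y) * f y) has_sum
      (\<Sum>k. t ^ k / fact k * (avg w ^^ k) f x)) UNIV"
  proof (rule has_sum_SigmaD)
    fix y
    have "((\<lambda>k. t ^ k / fact k * dheat w k x y) has_sum
        (\<Sum>k. t ^ k / fact k * dheat w k x y)) UNIV"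
      using exp_series_abs_summable[OF abs_dheat_le]
      by (intro norm_summable_imp_has_sum summable_sums hk_summable) (simp only: real_norm_def)
    from has_sum_cmult_left[OF this, of "f y"]
    show "((\<lambda>k. case (y, k) of (y, k) \<Rightarrow> g (k, y)) has_sum
        (\<Sum>k. t ^ k / fact k * dheat w k x y) * f y) UNIV"
      by (simp add: g_def)
  qed
  from has_sum_cmult_right[OF this, of "exp (- t)"] show ?thesis
    by (simp add: heat_ser_def hk_alt mult.assoc)
qed

text \<open>The functions on which \<open>heat_kernel\<close> is characterised become bounded, so
  that uniqueness of bounded solutions applies to them.\<close>

lemma l2_bounded:
  assumes c: "c > 0" and deg_ge: "\<And>x. deg w x \<ge> c" and f: "f \<in> l2 w"
  shows "\<exists>M. \<forall>x. \<bar>f x\<bar> \<le> M"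
proof -
  define S where "S = (\<Sum>\<^sub>\<infinity>x. deg w x * \<bar>f x\<bar>\<^sup>2)"
  have s: "((\<lambda>x. deg w x * \<bar>f x\<bar>\<^sup>2) has_sum S) UNIV"
    using f by (simp add: l2_def S_def)
  have "\<bar>f x\<bar> \<le> sqrt (S / c)" for x
  proof -
    have "deg w x * \<bar>f x\<bar>\<^sup>2 \<le> S"
      using has_sum_mono_neutral[OF has_sum_finite[of "{x}" "\<lambda>x. deg w x * \<bar>f x\<bar>\<^sup>2"] s] deg_nonneg
      by auto
    moreover have "c * \<bar>f x\<bar>\<^sup>2 \<le> deg w x * \<bar>f x\<bar>\<^sup>2"
      using deg_ge by (intro mult_right_mono) auto
    ultimately have "\<bar>f x\<bar>\<^sup>2 \<le> S / c"
      using c by (simp add: field_simps)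
    then show ?thesis
      by (rule real_le_rsqrt)
  qed
  then show ?thesis by blast
qed

lemma heat_kernel_eq_hk:
  assumes c: "c > 0" and deg_ge: "\<And>x. deg w x \<ge> c" and t: "0 \<le> t"
  shows "heat_kernel w t = hk t"
  unfolding heat_kernel_def
proof (rule the_equality)
  show "\<forall>f\<in>l2 w. \<forall>x. ((\<lambda>y. deg w y * hk t x y * f y) has_sum heat_semigroup w t f x) UNIV"
  proof (intro ballI allI)
    fix f x assume "f \<in> l2 w"
    then obtain M where "\<And>x. \<bar>f x\<bar> \<le> M"
      using l2_bounded[OF c deg_ge] by blast
    then show "((\<lambda>y. deg w y * hk t x y * f y) has_sum heat_semigroup w t f x) UNIV"
      using hk_has_sum[of f M t x] heat_semigroup_eq_heat_ser[of f M t x] t by simp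
  qed
next
  fix q assume q: "\<forall>f\<in>l2 w. \<forall>x. ((\<lambda>y. deg w y * q x y * f y) has_sum heat_semigroup w t f x) UNIV"
  have "q x z = hk t x z" for x z
  proof -
    define f where "f y = (if y = z then 1 else 0 :: real)" for y
    have "(\<lambda>y. deg w y * \<bar>f y\<bar>\<^sup>2) summable_on UNIV"
      by (rule has_sum_imp_summable, rule has_sum_finite_neutralI[of "{z}"]) (auto simp: f_def)
    then have "((\<lambda>y. deg w y * q x y * f y) has_sum heat_semigroup w t f x) UNIV"
      using q by (simp add: l2_def)
    moreover have "((\<lambda>y. deg w y * q x y * f y) has_sum deg w z * q x z) UNIV"
      by (rule has_sum_finite_neutralI[of "{z}"]) (auto simp: f_def)
    moreover have "heat_semigroup w t f x = heat_ser f t x"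
      by (rule heat_semigroup_eq_heat_ser[OF _ t, of f 1]) (simp add: f_def)
    ultimately have "deg w z * q x z = heat_ser f t x"
      using has_sum_unique by fastforce
    then show ?thesis
      by (simp add: hk_def f_def[abs_def] field_simps)
  qed
  then show "q = hk t" by blast
qed

end

section \<open>The on-diagonal bound\<close>

context wgraph
begin

lemma gballD:
  assumes "y \<in> gball w x r"
  shows "\<exists>k. real k \<le> r \<and> (x, y) \<in> {(u, v). v \<in> nbrs w u} ^^ k"
proof -
  define S where "S = {k. (x, y) \<in> {(u, v). v \<in> nbrs w u} ^^ k}"
  have le: "ereal_of_enat (INF k\<in>S. enat k) \<le> ereal r"
    using assms by (simp add: gball_def gdist_def S_def)
  \<comment> \<open>The infimum over the empty set is infinite, while \<open>r\<close> is
    real.\<close>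
  have "S \<noteq> {}"
    using le by (auto simp: top_enat_def)
  then have "(INF k\<in>S. enat k) \<in> enat ` S"
    unfolding Inf_enat_def by (auto intro: LeastI)
  then obtain k where "k \<in> S" "(INF k\<in>S. enat k) = enat k"
    by auto
  then show ?thesis
    using le by (auto simp: S_def)
qed

lemma gball_half: "gball w x (1 / 2) \<subseteq> {x}"
proof
  fix y assume "y \<in> gball w x (1 / 2)"
  then obtain k where k: "real k \<le> 1 / 2" "(x, y) \<in> {(u, v). v \<in> nbrs w u} ^^ k"
    using gballD by blast
  then have "real k < real 1" by simp
  then show "y \<in> {x}"
    using k(2) by (cases k) auto
qed

lemma lipschitz_relpow:
  assumes L: "\<And>x y. y \<in> nbrs w x \<Longrightarrow> \<bar>u y - u x\<bar> \<le> L"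
    and "(x, y) \<in> {(u, v). v \<in> nbrs w u} ^^ k"
  shows "\<bar>u y - u x\<bar> \<le> real k * L"
  using assms(2)
proof (induction k arbitrary: y)
  case (Suc k)
  then obtain z where z: "(x, z) \<in> {(u, v). v \<in> nbrs w u} ^^ k" "y \<in> nbrs w z"
    by auto
  show ?case
    using Suc.IH[OF z(1)] L[OF z(2)] by (simp add: distrib_right)
qed simp

end

locale volume_growth = wgraph +
  fixes c\<^sub>0 D :: real
  assumes c0_pos: "c\<^sub>0 > 0" and D_pos: "D > 0"
    and growth: "\<And>x r. r \<ge> 0 \<Longrightarrow> vol w (gball w x r) \<ge> c\<^sub>0 * r powr D"
begin

text \<open>An infinite ball would have volume \<open>0\<close>, the junk value of a sum over an infinite set.\<close>

lemma finite_gball: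
  assumes "r > 0"
  shows "finite (gball w x r)"
proof (rule ccontr)
  assume "infinite (gball w x r)"
  then have "c\<^sub>0 * r powr D \<le> 0"
    using growth[of r x] assms by (simp add: vol_def)
  then show False
    using c0_pos assms by (simp add: mult_le_0_iff)
qed

text \<open>The growth bound at radius 1/2: such a ball contains at most its centre, so this bounds
  every degree from below.\<close>

definition deg_min :: real where
  "deg_min = c\<^sub>0 * (1 / 2) powr D"

lemma deg_min_pos: "deg_min > 0"
  using c0_pos by (simp add: deg_min_def)

lemma deg_ge: "deg w x \<ge> deg_min"
proof -
  have "deg_min \<le> vol w (gball w x (1 / 2))"
    unfolding deg_min_def by (rule growth) simp
  also have "\<dots> \<le> (\<Sum>y\<in>{x}. deg w y)"
    unfolding vol_def by (rule sum_mono2[OF _ gball_half]) (simp_all add: deg_nonneg)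
  finally show ?thesis by simp
qed

text \<open>The kernel restarted at time \<open>t\<close> is a solution with values between 0 and
  \<open>B\<close>, so after a further time \<open>t\<close> its edge differences are at most
  \<open>L\<close>, a constant times \<open>B / sqrt t\<close>. At least half of the value
  \<open>v\<close> at \<open>x\<close> therefore survives on the ball of radius
  \<open>v / (2 * L)\<close>, and the mass there is at most 1.\<close>

lemma hk_doubling_step:
  assumes CDE: "CDE' w n 0" and n: "n > 0" and \<Delta>: "Delta_cond w \<alpha>" and \<alpha>: "\<alpha> > 0"
    and t: "t > 0" and B: "B > 0" and le: "\<And>x z. hk t x z \<le> B" and v: "hk (2 * t) x z > 0"
  shows "c\<^sub>0 * (hk (2 * t) x z * sqrt t / (2 * sqrt (32 * n / \<alpha>) * B)) powr D
    * (hk (2 * t) x z / 2) \<le> 1"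
proof -
  define u where "u s y = hk (s + t) y z" for s y
  have u: "heat_eq u"
    unfolding heat_eq_def u_def
  proof (intro allI impI)
    fix s :: real and y assume "0 \<le> s"
    then show "((\<lambda>s. hk (s + t) y z) has_real_derivative lap w (\<lambda>y. hk (s + t) y z) y) (at s)"
      using heat_eqD[OF heat_eq_hk[of z], of "s + t" y] t by (simp add: DERIV_shift)
  qed
  have u_nonneg: "0 \<le> u s y" if "0 \<le> s" for s y
    unfolding u_def using that t by (intro hk_nonneg) simp
  have u_le: "u s y \<le> B" if "0 \<le> s" for s y
  \<comment> \<open>\<open>1 / deg w z\<close> is the a priori bound that the maximum principle asks
    for; the bound \<open>B\<close> is inherited from the initial time.\<close>
  proof (rule heat_eq_le[OF u, where T = s and K = "1 / deg w z"])
    show "u s' y \<le> 1 / deg w z" if "0 \<le> s'" for s' y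
      unfolding u_def using that t by (intro hk_le) simp
    show "u 0 y \<le> B" for y
      using le by (simp add: u_def)
  qed (use that in auto)
  define L where "L = B * sqrt (32 * n / \<alpha>) / sqrt t"
  have L: "\<bar>u t y - u t x\<bar> \<le> L" if "y \<in> nbrs w x" for x y
    unfolding L_def by (rule heat_gradient_bound[OF CDE n \<Delta> \<alpha> u u_nonneg u_le t that B])
  have L_pos: "L > 0"
    unfolding L_def using B n \<alpha> t by simp
  define v where "v = hk (2 * t) x z"
  have v_eq: "v = u t x"
    unfolding v_def u_def mult_2 ..
  have v_pos: "v > 0"
    using v by (simp add: v_def)
  define r where "r = v / (2 * L)"
  have r: "r > 0"
    using v_pos L_pos by (simp add: r_def)
  have near: "v / 2 \<le> hk (2 * t) y z" if y: "y \<in> gball w x r" for y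
  proof -
    obtain k where k: "real k \<le> r" "(x, y) \<in> {(u, v). v \<in> nbrs w u} ^^ k"
      using gballD[OF y] by blast
    have "\<bar>u t y - u t x\<bar> \<le> real k * L"
      by (rule lipschitz_relpow[OF L k(2)])
    also have "\<dots> \<le> r * L"
      using k(1) L_pos by (intro mult_right_mono) auto
    also have "\<dots> = v / 2"
      using L_pos by (simp add: r_def)
    finally have "v / 2 \<le> u t y"
      using v_eq by linarith
    then show ?thesis
      unfolding u_def mult_2 .
  qed
  have "c\<^sub>0 * r powr D * (v / 2) \<le> vol w (gball w x r) * (v / 2)"
    using growth[of r x] r v_pos by (intro mult_right_mono) auto
  also have "\<dots> \<le> (\<Sum>y\<in>gball w x r. deg w y * hk (2 * t) y z)"
    unfolding vol_def sum_distrib_right using near deg_nonneg by (intro sum_mono mult_left_mono) auto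
  also have "\<dots> \<le> 1"
    using finite_gball[OF r] t by (intro hk_sum_le_1) auto
  finally show ?thesis
    unfolding r_def L_def v_def by (simp add: mult_ac)
qed

text \<open>If the bound with constant \<open>A\<close> failed at time \<open>2t\<close> but not at time \<open>t\<close>, the kernel
  would be comparable to its maximum on a ball of radius comparable to \<open>\<surd>t\<close>, and its
  total mass would exceed \<open>1\<close>.\<close>

lemma hk_upper_bound:
  assumes CDE: "CDE' w n 0" and n: "n > 0" and \<Delta>: "Delta_cond w \<alpha>" and \<alpha>: "\<alpha> > 0"
  shows "\<exists>A>0. \<forall>t>0. \<forall>x z. hk t x z \<le> A * t powr (- D / 2)"
proof -
  define L where "L = sqrt (32 * n / \<alpha>)"
  have L: "L > 0"
    using n \<alpha> by (simp add: L_def)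
  define q where "q = 2 powr (- D / 2)"
  have q: "q > 0" by (simp add: q_def)
  \<comment> \<open>The first entry settles times up to 1 by the trivial bound on the kernel; the
    second makes a failure at \<open>2 * t\<close> contradictory. Neither depends on time, so one
    constant passes through all doublings.\<close>
  define A where "A = max (1 / deg_min) (2 / (c\<^sub>0 * (q / (2 * L)) powr D * q))"
  have A: "A > 0" "1 / deg_min \<le> A"
    using deg_min_pos by (auto simp: A_def less_max_iff_disj)
  have A2: "2 \<le> c\<^sub>0 * (q / (2 * L)) powr D * q * A"
  proof -
    have p: "c\<^sub>0 * (q / (2 * L)) powr D * q > 0"
      using c0_pos q L by simp
    have "2 / (c\<^sub>0 * (q / (2 * L)) powr D * q) \<le> A"
      by (simp add: A_def)
    then show ?thesis
      unfolding pos_divide_le_eq[OF p] by (simp only: mult.commute)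
  qed
  have step: "hk (2 * t) x z \<le> A * (2 * t) powr (- D / 2)"
    if t: "t > 0" and le: "\<And>x z. hk t x z \<le> A * t powr (- D / 2)" for t x z
  proof (rule ccontr)
    define v where "v = hk (2 * t) x z"
    define B where "B = A * t powr (- D / 2)"
    have B: "B > 0" using A t by (simp add: B_def)
    assume "\<not> ?thesis"
    then have v: "v > q * B"
      using t by (simp add: v_def q_def B_def powr_mult mult_ac)
    then have v_pos: "v > 0"
      using q B by (meson less_trans mult_pos_pos)
    have "c\<^sub>0 * (v * sqrt t / (2 * L * B)) powr D * (v / 2) \<le> 1"
      unfolding v_def L_def
      by (rule hk_doubling_step[OF CDE n \<Delta> \<alpha> t B]) (use le v_pos in \<open>auto simp: v_def B_def\<close>)
    moreover have "1 < c\<^sub>0 * (v * sqrt t / (2 * L * B)) powr D * (v / 2)"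
    proof -
      \<comment> \<open>Scale invariance: the power of \<open>sqrt t\<close> from the volume of the
        ball cancels the one in \<open>B\<close>, which leaves a condition on \<open>A\<close>
        alone.\<close>
      have A_eq: "A = sqrt t powr D * B"
      proof -
        have "sqrt t = t powr (1 / 2)"
          using t by (simp add: powr_half_sqrt)
        then have "sqrt t powr D = t powr (D / 2)"
          by (simp only: powr_powr) simp
        then show ?thesis
          using t by (simp add: B_def powr_minus field_simps)
      qed
      then have "1 \<le> c\<^sub>0 * (q / (2 * L) * sqrt t) powr D * (q * B / 2)"
        using A2 unfolding powr_mult A_eq by (simp add: mult_ac)
      also have "\<dots> < c\<^sub>0 * (q / (2 * L) * sqrt t) powr D * (v / 2)"
        using v c0_pos q L t by (intro mult_strict_left_mono) auto
      also have "\<dots> \<le> c\<^sub>0 * (v * sqrt t / (2 * L * B)) powr D * (v / 2)"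
      proof -
        have "q / (2 * L) * sqrt t = q * B * sqrt t / (2 * L * B)"
          using B by simp
        also have "\<dots> \<le> v * sqrt t / (2 * L * B)"
          using v B L t by (intro divide_right_mono mult_right_mono) auto
        finally show ?thesis
          using c0_pos v_pos q L t D_pos by (intro mult_right_mono mult_left_mono powr_mono2) auto
      qed
      finally show ?thesis .
    qed
    ultimately show False by simp
  qed
  have "\<forall>x z. hk t x z \<le> A * t powr (- D / 2)" if "0 < t" "t \<le> 2 ^ j" for t :: real and j :: nat
    using that
  proof (induction j arbitrary: t)
    case 0
    show ?case
    proof (intro allI)
      fix x z
      have "hk t x z \<le> 1 / deg w z"
        using 0 by (intro hk_le) simp
      also have "\<dots> \<le> 1 / deg_min"
        using deg_ge[of z] deg_min_pos by (intro divide_left_mono) auto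
      also have "\<dots> \<le> A" by (rule A)
      also have "\<dots> \<le> A * t powr (- D / 2)"
      proof -
        have "t powr (D / 2) \<le> 1"
          using 0 D_pos by (intro powr_le1) auto
        then show ?thesis
          using A(1) 0 by (simp add: powr_minus_divide field_simps)
      qed
      finally show "hk t x z \<le> A * t powr (- D / 2)" .
    qed
  next
    case (Suc j)
    then have "\<forall>x z. hk (t / 2) x z \<le> A * (t / 2) powr (- D / 2)"
      by (intro Suc.IH) auto
    then show ?case
      using step[of "t / 2"] Suc.prems by simp
  qed
  moreover have "\<exists>j. t \<le> 2 ^ j" for t :: real
    using real_arch_pow[of 2 t] by (auto intro: less_imp_le)
  ultimately show ?thesis
    using A(1) by blast
qed

end

section \<open>Integration of finitely supported functions\<close>

context wgraph
begin

lemma integ_eq_sum: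
  assumes "finite A" "supp f \<subseteq> A"
  shows "integ w f = (\<Sum>x\<in>A. deg w x * f x)"
  unfolding integ_def
  by (rule infsumI, rule has_sum_finite_neutralI[of A]) (use assms in \<open>auto simp: supp_def\<close>)

lemma lpnorm_eq_sum:
  assumes "finite A" "supp f \<subseteq> A" "p \<noteq> 0"
  shows "lpnorm w p f = (\<Sum>x\<in>A. deg w x * \<bar>f x\<bar> powr p) powr (1 / p)"
proof -
  have "(\<Sum>\<^sub>\<infinity>x. deg w x * \<bar>f x\<bar> powr p) = (\<Sum>x\<in>A. deg w x * \<bar>f x\<bar> powr p)"
    by (rule infsumI, rule has_sum_finite_neutralI[of A]) (use assms in \<open>auto simp: supp_def\<close>)
  then show ?thesis by (simp add: lpnorm_def)
qed

lemma finite_supp_add: "finite (supp f) \<Longrightarrow> finite (supp g) \<Longrightarrow> finite (supp (\<lambda>x. f x + g x))"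
  by (rule finite_subset[of _ "supp f \<union> supp g"]) (auto simp: supp_def)

lemma finite_supp_diff: "finite (supp f) \<Longrightarrow> finite (supp g) \<Longrightarrow> finite (supp (\<lambda>x. f x - g x))"
  by (rule finite_subset[of _ "supp f \<union> supp g"]) (auto simp: supp_def)

lemma finite_supp_mult: "finite (supp f) \<Longrightarrow> finite (supp (\<lambda>x. f x * g x))"
  by (rule finite_subset[of _ "supp f"]) (auto simp: supp_def)

lemma finite_supp_cmult: "finite (supp f) \<Longrightarrow> finite (supp (\<lambda>x. c * f x))"
  by (rule finite_subset[of _ "supp f"]) (auto simp: supp_def)

lemma finite_supp_power2: "finite (supp f) \<Longrightarrow> finite (supp (\<lambda>x. (f x)\<^sup>2))"
  by (simp add: supp_def)

lemma supp_avg: "supp (avg w f) \<subseteq> (\<Union>y\<in>supp f. nbrs w y)"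
proof
  fix x assume "x \<in> supp (avg w f)"
  then have "(\<Sum>y\<in>nbrs w x. w x y * f y) \<noteq> 0"
    by (auto simp: supp_def avg_def)
  then obtain y where "y \<in> nbrs w x" "w x y * f y \<noteq> 0"
    by (rule sum.not_neutral_contains_not_neutral)
  then show "x \<in> (\<Union>y\<in>supp f. nbrs w y)"
    using nbrs_sym[of y x] by (auto simp: supp_def)
qed

lemma finite_supp_avg: "finite (supp f) \<Longrightarrow> finite (supp (avg w f))"
  by (rule finite_subset[OF supp_avg]) (auto simp: finite_nbrs)

lemma finite_supp_avg_pow: "finite (supp f) \<Longrightarrow> finite (supp ((avg w ^^ k) f))"
  by (induction k) (auto intro: finite_supp_avg)

lemmas finite_supp_intros = finite_supp_add finite_supp_diff finite_supp_mult finite_supp_cmult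
  finite_supp_power2 finite_supp_avg finite_supp_avg_pow

lemma integ_add:
  assumes "finite (supp f)" "finite (supp g)"
  shows "integ w (\<lambda>x. f x + g x) = integ w f + integ w g"
proof -
  have "finite (supp f \<union> supp g)" using assms by simp
  moreover have "supp (\<lambda>x. f x + g x) \<subseteq> supp f \<union> supp g" by (auto simp: supp_def)
  ultimately show ?thesis
    using integ_eq_sum[of "supp f \<union> supp g"] by (simp add: sum.distrib distrib_left)
qed

lemma integ_cmult:
  assumes "finite (supp f)"
  shows "integ w (\<lambda>x. c * f x) = c * integ w f"
proof -
  have "supp (\<lambda>x. c * f x) \<subseteq> supp f" by (auto simp: supp_def)
  then show ?thesis
    using integ_eq_sum[OF assms] by (simp add: sum_distrib_left mult.left_commute)
qed

lemma integ_diff: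
  assumes "finite (supp f)" "finite (supp g)"
  shows "integ w (\<lambda>x. f x - g x) = integ w f - integ w g"
  using integ_add[OF assms(1) finite_supp_cmult[OF assms(2)], of "- 1"] integ_cmult[OF assms(2), of "- 1"]
  by simp

lemma integ_mono:
  assumes "finite (supp f)" "finite (supp g)" "\<And>x. f x \<le> g x"
  shows "integ w f \<le> integ w g"
proof -
  have "finite (supp f \<union> supp g)" using assms by simp
  then show ?thesis
    using integ_eq_sum[of "supp f \<union> supp g"] assms(3) deg_nonneg
    by (simp add: sum_mono mult_left_mono)
qed

lemma integ_nonneg:
  assumes "\<And>x. f x \<ge> 0"
  shows "integ w f \<ge> 0"
  unfolding integ_def by (rule infsum_nonneg) (simp add: assms deg_nonneg)

section \<open>Stationarity, symmetry and spectral bounds of averaging\<close>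

lemma deg_mult_avg:
  assumes "finite A" "supp f \<subseteq> A"
  shows "deg w x * avg w f x = (\<Sum>y\<in>A. w x y * f y)"
proof -
  have "(\<Sum>y\<in>nbrs w x. w x y * f y) = (\<Sum>y\<in>nbrs w x \<inter> A. w x y * f y)"
    by (rule sum.mono_neutral_right) (use assms finite_nbrs in \<open>auto simp: supp_def\<close>)
  also have "\<dots> = (\<Sum>y\<in>A. w x y * f y)"
    by (rule sum.mono_neutral_left) (use assms weight_eq_0[of _ x] in auto)
  finally show ?thesis by (simp add: avg_def)
qed

lemma integ_avg:
  assumes "finite (supp f)"
  shows "integ w (avg w f) = integ w f"
proof -
  define A where "A = supp f"
  define B where "B = (\<Union>y\<in>A. nbrs w y)"
  have fin: "finite A" "finite B"
    using assms finite_nbrs by (auto simp: A_def B_def)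
  have "integ w (avg w f) = (\<Sum>x\<in>B. \<Sum>y\<in>A. w x y * f y)"
    using integ_eq_sum[OF fin(2), of "avg w f"] supp_avg[of f] deg_mult_avg[OF fin(1), of f]
    by (simp add: A_def B_def)
  also have "\<dots> = (\<Sum>y\<in>A. \<Sum>x\<in>B. w x y * f y)"
    by (rule sum.swap)
  also have "\<dots> = (\<Sum>y\<in>A. deg w y * f y)"
  proof (rule sum.cong)
    fix y assume "y \<in> A"
    then have "(\<Sum>x\<in>nbrs w y. w y x) = (\<Sum>x\<in>B. w y x)"
      using fin(2) by (intro sum.mono_neutral_left) (auto simp: B_def weight_eq_0)
    then show "(\<Sum>x\<in>B. w x y * f y) = deg w y * f y"
      by (simp add: deg_def sum_distrib_right weight_sym[of _ y])
  qed simp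
  also have "\<dots> = integ w f"
    by (rule integ_eq_sum[symmetric]) (use fin in \<open>auto simp: A_def\<close>)
  finally show ?thesis .
qed

lemma integ_mult_avg:
  assumes "finite (supp f)" "finite (supp g)"
  shows "integ w (\<lambda>x. f x * avg w g x) = integ w (\<lambda>x. avg w f x * g x)"
proof -
  define A where "A = supp f \<union> supp g"
  have A: "finite A" "supp f \<subseteq> A" "supp g \<subseteq> A"
    using assms by (auto simp: A_def)
  have "integ w (\<lambda>x. f x * avg w g x) = (\<Sum>x\<in>A. f x * (deg w x * avg w g x))"
    using A(2) by (subst integ_eq_sum[OF A(1)]) (auto simp: supp_def mult_ac)
  also have "\<dots> = (\<Sum>x\<in>A. \<Sum>y\<in>A. f x * (w x y * g y))"
    by (simp only: deg_mult_avg[OF A(1,3)] sum_distrib_left)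
  also have "\<dots> = (\<Sum>y\<in>A. \<Sum>x\<in>A. f x * (w x y * g y))"
    by (rule sum.swap)
  also have "\<dots> = (\<Sum>y\<in>A. deg w y * avg w f y * g y)"
    unfolding deg_mult_avg[OF A(1,2)] sum_distrib_right
    by (intro sum.cong refl) (simp add: weight_sym mult_ac)
  also have "\<dots> = integ w (\<lambda>x. avg w f x * g x)"
    using A(3) by (subst integ_eq_sum[OF A(1)]) (auto simp: supp_def mult_ac)
  finally show ?thesis .
qed

lemma integ_mult_avg_pow:
  assumes "finite (supp f)" "finite (supp g)"
  shows "integ w (\<lambda>x. f x * (avg w ^^ k) g x) = integ w (\<lambda>x. (avg w ^^ k) f x * g x)"
  using assms
proof (induction k arbitrary: f)
  case (Suc k)
  have "integ w (\<lambda>x. f x * (avg w ^^ Suc k) g x) = integ w (\<lambda>x. avg w f x * (avg w ^^ k) g x)"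
    using integ_mult_avg[OF Suc.prems(1) finite_supp_avg_pow[OF Suc.prems(2)]] by simp
  also have "\<dots> = integ w (\<lambda>x. (avg w ^^ Suc k) f x * g x)"
    using Suc.IH[OF finite_supp_avg[OF Suc.prems(1)] Suc.prems(2)] by (simp add: funpow_swap1)
  finally show ?case .
qed simp

lemma avg_power2_le: "(avg w f x)\<^sup>2 \<le> avg w (\<lambda>y. (f y)\<^sup>2) x"
proof -
  define a where "a = avg w f x"
  have "0 \<le> avg w (\<lambda>y. (f y - a)\<^sup>2) x"
    using avg_mono[of x "\<lambda>_. 0" "\<lambda>y. (f y - a)\<^sup>2"] by simp
  also have "(\<lambda>y. (f y - a)\<^sup>2) = (\<lambda>y. ((f y)\<^sup>2 - (2 * a) * f y) + a\<^sup>2)"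
    by (simp add: power2_eq_square algebra_simps)
  finally show ?thesis
    unfolding avg_add avg_diff avg_cmult avg_const by (simp add: a_def power2_eq_square)
qed

lemma integ_avg_power2_le:
  assumes "finite (supp f)"
  shows "integ w (\<lambda>x. (avg w f x)\<^sup>2) \<le> integ w (\<lambda>x. (f x)\<^sup>2)"
proof -
  have "integ w (\<lambda>x. (avg w f x)\<^sup>2) \<le> integ w (avg w (\<lambda>x. (f x)\<^sup>2))"
    by (intro integ_mono finite_supp_intros assms avg_power2_le)
  then show ?thesis
    by (simp add: integ_avg finite_supp_intros assms)
qed

lemma integ_Gam:
  assumes "finite (supp f)"
  shows "integ w (Gam w f f) = integ w (\<lambda>x. (f x)\<^sup>2) - integ w (\<lambda>x. f x * avg w f x)"
proof -
  have "Gam w f f = (\<lambda>x. (1 / 2) * (avg w (\<lambda>y. (f y)\<^sup>2) x + (f x)\<^sup>2) - f x * avg w f x)"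
    by (auto simp: fun_eq_iff Gam_alt lap_eq_avg power2_eq_square field_simps)
  then have "integ w (Gam w f f) =
      (1 / 2) * (integ w (avg w (\<lambda>y. (f y)\<^sup>2)) + integ w (\<lambda>x. (f x)\<^sup>2)) - integ w (\<lambda>x. f x * avg w f x)"
    by (simp only: integ_diff integ_add integ_cmult finite_supp_intros assms)
  then show ?thesis
    by (simp add: integ_avg finite_supp_intros assms)
qed

lemma finite_supp_Gam:
  assumes "finite (supp f)"
  shows "finite (supp (Gam w f f))"
proof -
  have "Gam w f f = (\<lambda>x. (1 / 2) * (avg w (\<lambda>y. (f y)\<^sup>2) x + (f x)\<^sup>2) - f x * avg w f x)"
    by (auto simp: fun_eq_iff Gam_alt lap_eq_avg power2_eq_square field_simps)
  then show ?thesis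
    by (simp only: finite_supp_intros assms)
qed

text \<open>The spectrum of averaging is bounded below by -1: the square of the sum
  \<open>f y + f x\<close> is integrated in place of that of the difference.\<close>

lemma integ_power2_add_mult_avg_nonneg:
  assumes "finite (supp f)"
  shows "0 \<le> integ w (\<lambda>x. (f x)\<^sup>2) + integ w (\<lambda>x. f x * avg w f x)"
proof -
  have "0 \<le> avg w (\<lambda>y. (f y)\<^sup>2) x + 2 * (f x * avg w f x) + (f x)\<^sup>2" for x
  proof -
    have "0 \<le> avg w (\<lambda>y. (f y + f x)\<^sup>2) x"
      using avg_mono[of x "\<lambda>_. 0" "\<lambda>y. (f y + f x)\<^sup>2"] by simp
    also have "(\<lambda>y. (f y + f x)\<^sup>2) = (\<lambda>y. (f y)\<^sup>2 + (2 * f x) * f y + (f x)\<^sup>2)"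
      by (simp add: power2_eq_square algebra_simps)
    finally show ?thesis
      unfolding avg_add avg_diff avg_cmult avg_const by simp
  qed
  then have "0 \<le> integ w (\<lambda>x. avg w (\<lambda>y. (f y)\<^sup>2) x + 2 * (f x * avg w f x) + (f x)\<^sup>2)"
    by (rule integ_nonneg)
  also have "\<dots> = integ w (avg w (\<lambda>y. (f y)\<^sup>2)) + 2 * integ w (\<lambda>x. f x * avg w f x) + integ w (\<lambda>x. (f x)\<^sup>2)"
    by (simp only: integ_add integ_cmult finite_supp_intros assms)
  finally show ?thesis
    by (simp add: integ_avg finite_supp_intros assms)
qed

text \<open>With \<open>c\<^sub>j = \<langle>f, P\<^sup>j f\<rangle>\<close> and \<open>g = (1 - P) P\<^sup>i f\<close>, the two inequalities used here are
  \<open>c\<^sub>2\<^sub>i - 2 c\<^sub>2\<^sub>i\<^sub>+\<^sub>1 + c\<^sub>2\<^sub>i\<^sub>+\<^sub>2 = \<langle>g, g\<rangle> \<ge> 0\<close> and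
  \<open>c\<^sub>2\<^sub>i - c\<^sub>2\<^sub>i\<^sub>+\<^sub>1 - c\<^sub>2\<^sub>i\<^sub>+\<^sub>2 + c\<^sub>2\<^sub>i\<^sub>+\<^sub>3 = \<langle>g, (1 + P) g\<rangle> \<ge> 0\<close>, which replace the
  spectral inequality \<open>1 - \<lambda>\<^sup>k \<le> k (1 - \<lambda>)\<close> for \<open>\<bar>\<lambda>\<bar> \<le> 1\<close>.\<close>

lemma integ_mult_avg_pow_ge:
  assumes f: "finite (supp f)"
  shows "integ w (\<lambda>x. (f x)\<^sup>2) - real k * integ w (Gam w f f) \<le> integ w (\<lambda>x. f x * (avg w ^^ k) f x)"
proof -
  define c where "c k = integ w (\<lambda>x. f x * (avg w ^^ k) f x)" for k
  define b where "b k = c k - c (Suc k)" for k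
  have c_add: "integ w (\<lambda>x. (avg w ^^ i) f x * (avg w ^^ j) f x) = c (i + j)" for i j
    using integ_mult_avg_pow[OF f finite_supp_avg_pow[OF f, of j], of i]
    by (simp add: c_def funpow_add)
  have c_0: "c 0 = integ w (\<lambda>x. (f x)\<^sup>2)"
    by (simp add: c_def power2_eq_square)
  have b_0: "b 0 = integ w (Gam w f f)"
    by (simp add: b_def c_0 integ_Gam[OF f]) (simp add: c_def)
  \<comment> \<open>Averaging may have negative spectrum, and then \<open>b\<close> need not
    decrease in single steps. What persists is that the terms of even index decrease and that each
    odd term is at most the even one before it.\<close>
  have even: "b (2 * Suc i) \<le> b (2 * i)" and odd: "b (Suc (2 * i)) \<le> b (2 * i)" for i
  proof -
    define h where "h j = (avg w ^^ (i + j)) f" for j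
    define g where "g x = h 0 x - h 1 x" for x
    have h: "integ w (\<lambda>x. h j x * h l x) = c (2 * i + (j + l))" for j l
      using c_add[of "i + j" "i + l"] by (simp add: h_def mult_2 add_ac)
    have fin: "finite (supp (h j))" for j
      by (simp add: h_def finite_supp_avg_pow f)
    have avg_g: "avg w g x = h 1 x - h 2 x" for x
      unfolding g_def avg_diff by (simp add: h_def)
    have "(\<lambda>x. (g x)\<^sup>2) = (\<lambda>x. h 0 x * h 0 x - 2 * (h 0 x * h 1 x) + h 1 x * h 1 x)"
      by (auto simp: fun_eq_iff g_def power2_eq_square algebra_simps)
    then have "integ w (\<lambda>x. (g x)\<^sup>2) = integ w (\<lambda>x. h 0 x * h 0 x)
        - 2 * integ w (\<lambda>x. h 0 x * h 1 x) + integ w (\<lambda>x. h 1 x * h 1 x)"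
      by (simp only: integ_diff integ_add integ_cmult finite_supp_intros fin)
    then have gg: "integ w (\<lambda>x. (g x)\<^sup>2) = c (2 * i) - 2 * c (2 * i + 1) + c (2 * i + 2)"
      by (simp add: h)
    have "(\<lambda>x. g x * avg w g x) =
        (\<lambda>x. (h 0 x * h 1 x - h 0 x * h 2 x) - h 1 x * h 1 x + h 1 x * h 2 x)"
      by (auto simp: fun_eq_iff g_def avg_g algebra_simps)
    then have "integ w (\<lambda>x. g x * avg w g x) = integ w (\<lambda>x. h 0 x * h 1 x)
        - integ w (\<lambda>x. h 0 x * h 2 x) - integ w (\<lambda>x. h 1 x * h 1 x) + integ w (\<lambda>x. h 1 x * h 2 x)"
      by (simp only: integ_diff integ_add integ_cmult finite_supp_intros fin)
    then have gPg: "integ w (\<lambda>x. g x * avg w g x) = c (2 * i + 1) - 2 * c (2 * i + 2) + c (2 * i + 3)"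
      by (simp add: h numeral_3_eq_3)
    have "finite (supp g)"
      unfolding g_def by (intro finite_supp_intros fin)
    from integ_power2_add_mult_avg_nonneg[OF this] show "b (2 * Suc i) \<le> b (2 * i)"
      unfolding gg gPg by (simp add: b_def numeral_3_eq_3)
    have "0 \<le> integ w (\<lambda>x. (g x)\<^sup>2)"
      by (rule integ_nonneg) simp
    then show "b (Suc (2 * i)) \<le> b (2 * i)"
      unfolding gg by (simp add: b_def)
  qed
  have b_even: "b (2 * i) \<le> b 0" for i
    by (induction i) (use even order.trans in \<open>auto simp del: mult_Suc_right\<close>)
  have b_le: "b j \<le> b 0" for j
  proof (cases "even j")
    case True
    then show ?thesis using b_even by (auto elim!: evenE)
  next
    case False
    then obtain i where "j = Suc (2 * i)" by (auto elim!: oddE)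
    then show ?thesis using odd[of i] b_even[of i] by simp
  qed
  have "c 0 - real k * b 0 \<le> c k"
  proof (induction k)
    case (Suc k)
    then show ?case
      using b_le[of k] by (simp add: b_def distrib_right)
  qed simp
  then show ?thesis
    by (simp add: c_0 b_0) (simp add: c_def)
qed

section \<open>From the kernel bound to Nash and Faber--Krahn\<close>

text \<open>The Poisson mean; it converts a loss proportional to the number \<open>k\<close> of
  steps into one proportional to the time \<open>t\<close>.\<close>

lemma exp_mean_sums: "(\<lambda>k. t ^ k / fact k * real k) sums (t * exp t)"
proof (rule sums_Suc_imp)
  have "t ^ Suc k / fact (Suc k) * real (Suc k) = t * (t ^ k / fact k)" for k
    by (simp add: fact_Suc del: of_nat_Suc)
  then show "(\<lambda>k. t ^ Suc k / fact (Suc k) * real (Suc k)) sums (t * exp t)"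
    using sums_mult[OF exp_sums] by simp
qed simp

lemma hk_sums: "(\<lambda>k. t ^ k / fact k * dheat w k x y) sums (exp t * deg w y * hk t x y)"
proof -
  have "exp t * deg w y * hk t x y = (\<Sum>k. t ^ k / fact k * dheat w k x y)"
    by (simp add: hk_alt exp_minus field_simps)
  then show ?thesis
    using summable_sums[OF hk_summable[of t x y]] by (simp only:)
qed

text \<open>Summed against Poisson weights, \<open>integ_mult_avg_pow_ge\<close> bounds the pairing
  of \<open>f\<close> with its heat flow from below; the bound \<open>B\<close> on the kernel bounds
  it from above.\<close>

lemma integ_power2_le_heat:
  assumes f: "finite (supp f)" and t: "t > 0" and le: "\<And>x z. hk t x z \<le> B"
  shows "integ w (\<lambda>x. (f x)\<^sup>2) \<le> t * integ w (Gam w f f) + B * (integ w (\<lambda>x. \<bar>f x\<bar>))\<^sup>2"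
proof -
  define F where "F = supp f"
  have F: "finite F" "supp f \<subseteq> F"
    using f by (auto simp: F_def)
  define c where "c k = integ w (\<lambda>x. f x * (avg w ^^ k) f x)" for k
  have c_alt: "c k = (\<Sum>x\<in>F. \<Sum>y\<in>F. deg w x * f x * f y * dheat w k x y)" for k
  proof -
    have "(avg w ^^ k) f x = (\<Sum>y\<in>F. dheat w k x y * f y)" for x
      by (rule has_sum_unique[OF dheat_has_sum], rule has_sum_finite_neutralI[of F])
         (use F in \<open>auto simp: supp_def\<close>)
    then show ?thesis
      unfolding c_def using F(2)
      by (subst integ_eq_sum[OF F(1)]) (auto simp: supp_def sum_distrib_left mult_ac)
  qed
  have 1: "(\<lambda>k. t ^ k / fact k * c k) sums
      (\<Sum>x\<in>F. \<Sum>y\<in>F. deg w x * f x * f y * (exp t * deg w y * hk t x y))"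
  proof -
    have "t ^ k / fact k * c k =
        (\<Sum>x\<in>F. \<Sum>y\<in>F. deg w x * f x * f y * (t ^ k / fact k * dheat w k x y))" for k
      unfolding c_alt sum_distrib_left by (simp only: mult_ac)
    then show ?thesis
      by (simp only:) (intro sums_sum sums_mult hk_sums)
  qed
  have 2: "(\<lambda>k. integ w (\<lambda>x. (f x)\<^sup>2) * (t ^ k / fact k) - integ w (Gam w f f) * (t ^ k / fact k * real k))
      sums (integ w (\<lambda>x. (f x)\<^sup>2) * exp t - integ w (Gam w f f) * (t * exp t))"
    by (intro sums_diff sums_mult exp_sums exp_mean_sums)
  have "integ w (\<lambda>x. (f x)\<^sup>2) * exp t - integ w (Gam w f f) * (t * exp t)
      \<le> (\<Sum>x\<in>F. \<Sum>y\<in>F. deg w x * f x * f y * (exp t * deg w y * hk t x y))"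
  proof (rule sums_le[OF _ 2 1])
    fix k
    have "t ^ k / fact k * (integ w (\<lambda>x. (f x)\<^sup>2) - real k * integ w (Gam w f f)) \<le> t ^ k / fact k * c k"
      unfolding c_def using t by (intro mult_left_mono integ_mult_avg_pow_ge f) auto
    then show "integ w (\<lambda>x. (f x)\<^sup>2) * (t ^ k / fact k) - integ w (Gam w f f) * (t ^ k / fact k * real k)
        \<le> t ^ k / fact k * c k"
      by (simp add: algebra_simps)
  qed
  also have "\<dots> \<le> (\<Sum>x\<in>F. \<Sum>y\<in>F. (deg w x * \<bar>f x\<bar>) * (deg w y * \<bar>f y\<bar>) * (exp t * B))"
  proof (intro sum_mono)
    fix x y
    have "deg w x * f x * f y * (exp t * deg w y * hk t x y) = (f x * f y) * (deg w x * deg w y * exp t * hk t x y)"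
      by (simp add: mult_ac)
    also have "\<dots> \<le> \<bar>f x * f y\<bar> * (deg w x * deg w y * exp t * hk t x y)"
      using t deg_nonneg hk_nonneg by (intro mult_right_mono mult_nonneg_nonneg) auto
    also have "\<dots> \<le> \<bar>f x * f y\<bar> * (deg w x * deg w y * exp t * B)"
      using le deg_nonneg by (intro mult_left_mono) auto
    finally show "deg w x * f x * f y * (exp t * deg w y * hk t x y)
        \<le> (deg w x * \<bar>f x\<bar>) * (deg w y * \<bar>f y\<bar>) * (exp t * B)"
      by (simp add: abs_mult mult_ac)
  qed
  also have "\<dots> = exp t * (B * (\<Sum>x\<in>F. deg w x * \<bar>f x\<bar>)\<^sup>2)"
    by (simp add: power2_eq_square sum_product flip: sum_distrib_right)
  also have "(\<Sum>x\<in>F. deg w x * \<bar>f x\<bar>) = integ w (\<lambda>x. \<bar>f x\<bar>)"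
    by (rule integ_eq_sum[symmetric]) (use F in \<open>auto simp: supp_def\<close>)
  finally have "exp t * integ w (\<lambda>x. (f x)\<^sup>2)
      \<le> exp t * (t * integ w (Gam w f f) + B * (integ w (\<lambda>x. \<bar>f x\<bar>))\<^sup>2)"
    by (simp add: algebra_simps)
  then show ?thesis by simp
qed

lemma integ_abs_power2_le:
  assumes "finite A" "supp f \<subseteq> A"
  shows "(integ w (\<lambda>x. \<bar>f x\<bar>))\<^sup>2 \<le> vol w A * integ w (\<lambda>x. (f x)\<^sup>2)"
proof -
  have "(integ w (\<lambda>x. \<bar>f x\<bar>))\<^sup>2 = (\<Sum>x\<in>A. sqrt (deg w x) * (sqrt (deg w x) * \<bar>f x\<bar>))\<^sup>2"
    using assms(2) deg_nonneg
    by (subst integ_eq_sum[OF assms(1)]) (auto simp: supp_def simp flip: mult.assoc)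
  also have "\<dots> \<le> (\<Sum>x\<in>A. (sqrt (deg w x))\<^sup>2) * (\<Sum>x\<in>A. (sqrt (deg w x) * \<bar>f x\<bar>)\<^sup>2)"
    by (rule Cauchy_Schwarz_ineq_sum)
  also have "\<dots> = vol w A * integ w (\<lambda>x. (f x)\<^sup>2)"
    using assms(2) deg_nonneg
    by (subst integ_eq_sum[OF assms(1)]) (auto simp: supp_def vol_def power_mult_distrib)
  finally show ?thesis .
qed

end

locale kernel_bound = wgraph +
  fixes A D :: real
  assumes A_pos: "A > 0" and D_pos': "D > 0"
    and hk_bound: "\<And>t x z. t > 0 \<Longrightarrow> hk t x z \<le> A * t powr (- D / 2)"
begin

lemma nash:
  assumes f: "finite (supp f)"
  shows "integ w (\<lambda>x. (f x)\<^sup>2) powr (1 + 2 / D)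
    \<le> 2 * (2 * A) powr (2 / D) * integ w (Gam w f f) * integ w (\<lambda>x. \<bar>f x\<bar>) powr (4 / D)"
proof -
  define X where "X = integ w (\<lambda>x. (f x)\<^sup>2)"
  define S where "S = integ w (\<lambda>x. \<bar>f x\<bar>)"
  define E where "E = integ w (Gam w f f)"
  have nonneg: "X \<ge> 0" "S \<ge> 0" "E \<ge> 0"
    by (auto simp: X_def S_def E_def intro!: integ_nonneg Gam_nonneg)
  show ?thesis
  proof (cases "X = 0")
    case True
    then show ?thesis
      unfolding X_def[symmetric] S_def[symmetric] E_def[symmetric] using nonneg by simp
  next
    case False
    then have X: "X > 0" using nonneg by simp
    have "S \<noteq> 0"
    proof
      assume "S = 0"
      have "X \<le> t * E" if "t > 0" for t
        using integ_power2_le_heat[OF f that hk_bound[OF that]] \<open>S = 0\<close>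
        unfolding X_def S_def E_def by simp
      \<comment> \<open>A time so small that the energy term falls below \<open>X\<close>; the
        summand 1 covers \<open>E = 0\<close>.\<close>
      from this[of "X / (2 * (E + 1))"] show False
        using X nonneg by (simp add: field_simps) (smt (verit) mult_nonneg_nonneg)
    qed
    then have S: "S > 0" using nonneg by simp
    \<comment> \<open>Chosen so that the kernel term \<open>A * t powr (- D / 2) * S\<^sup>2\<close>
      equals \<open>X / 2\<close> and can be absorbed on the left.\<close>
    define s where "s = 2 * A * S\<^sup>2 / X"
    have s: "s > 0" using A_pos S X by (simp add: s_def)
    define t where "t = s powr (2 / D)"
    have t: "t > 0" using s by (simp add: t_def)
    have "t powr (- D / 2) = 1 / s"
      using s D_pos' by (simp add: t_def powr_powr powr_minus_divide)
    then have "X \<le> t * E + A * (1 / s) * S\<^sup>2"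
      using integ_power2_le_heat[OF f t hk_bound[OF t]] unfolding X_def S_def E_def by simp
    also have "A * (1 / s) * S\<^sup>2 = X / 2"
      using A_pos S X by (simp add: s_def)
    finally have "X \<le> 2 * (t * E)" by simp
    then have "X * X powr (2 / D) \<le> 2 * (t * E) * X powr (2 / D)"
      by (rule mult_right_mono) simp
    also have "t = (2 * A) powr (2 / D) * S powr (4 / D) / X powr (2 / D)"
    proof -
      have "(S\<^sup>2) powr (2 / D) = S powr (4 / D)"
        using S by (simp add: powr_powr flip: powr_numeral)
      then show ?thesis
        by (simp add: t_def s_def powr_mult powr_divide)
    qed
    also have "2 * ((2 * A) powr (2 / D) * S powr (4 / D) / X powr (2 / D) * E) * X powr (2 / D)
        = 2 * (2 * A) powr (2 / D) * E * S powr (4 / D)"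
      using X by simp
    also have "X * X powr (2 / D) = X powr (1 + 2 / D)"
      using X by (simp add: powr_add)
    finally show ?thesis
      unfolding X_def S_def E_def .
  qed
qed

text \<open>As for Nash, the time is chosen so that the kernel term contributes half of the
  left-hand side. Cauchy--Schwarz on \<open>\<Omega>\<close> lets this time depend on the volume of
  \<open>\<Omega>\<close> instead of on \<open>f\<close>.\<close>

lemma faber_krahn:
  assumes \<Omega>: "finite \<Omega>" "supp f \<subseteq> \<Omega>"
  shows "integ w (\<lambda>x. (f x)\<^sup>2) \<le> 2 * (2 * A) powr (2 / D) * vol w \<Omega> powr (2 / D) * integ w (Gam w f f)"
proof (cases "\<Omega> = {}")
  case True
  then have "f = (\<lambda>_. 0)" using \<Omega>(2) by (auto simp: supp_def)
  then show ?thesis by (simp add: integ_def Gam_def)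
next
  case False
  have f: "finite (supp f)"
    using \<Omega> finite_subset by blast
  define V where "V = vol w \<Omega>"
  have V: "V > 0"
    unfolding V_def vol_def using False \<Omega>(1) deg_pos by (intro sum_pos) auto
  define X where "X = integ w (\<lambda>x. (f x)\<^sup>2)"
  define t where "t = (2 * A * V) powr (2 / D)"
  have AV: "2 * A * V > 0"
    using A_pos V by simp
  then have t: "t > 0"
    using A_pos V by (simp add: t_def)
  have "t powr (- D / 2) = (2 * A * V) powr (- 1)"
    using D_pos' by (simp add: t_def powr_powr)
  then have "t powr (- D / 2) = 1 / (2 * A * V)"
    using AV by (simp only: powr_minus_divide powr_one less_imp_le)
  then have "X \<le> t * integ w (Gam w f f) + A * (1 / (2 * A * V)) * (integ w (\<lambda>x. \<bar>f x\<bar>))\<^sup>2"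
    using integ_power2_le_heat[OF f t hk_bound[OF t]] unfolding X_def by simp
  also have "\<dots> \<le> t * integ w (Gam w f f) + A * (1 / (2 * A * V)) * (V * X)"
    unfolding V_def X_def using A_pos V
    by (intro add_left_mono mult_left_mono integ_abs_power2_le \<Omega>) (auto simp: V_def)
  also have "A * (1 / (2 * A * V)) * (V * X) = X / 2"
    using A_pos V by simp
  finally have "X \<le> 2 * t * integ w (Gam w f f)" by simp
  then show ?thesis
    by (simp add: X_def t_def V_def powr_mult mult_ac)
qed

end

section \<open>The discrete-time kernel\<close>

context wgraph
begin

lemma finite_supp_point: "finite (supp (\<lambda>y. if y = z then 1 else 0 :: real))"
  by (rule finite_subset[of _ "{z}"]) (auto simp: supp_def)

text \<open>Chapman--Kolmogorov in symmetric form, from self-adjointness of averaging tested on two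
  point masses. It turns return probabilities at even times into squared norms.\<close>

lemma integ_dheat_mult_dheat:
  "integ w (\<lambda>u. dheat w i u x * dheat w j u y) = deg w x * dheat w (i + j) x y"
proof -
  define p where "p z = (\<lambda>y. if y = z then 1 else 0 :: real)" for z :: 'v
  have fin: "finite (supp (p z))" for z
    unfolding p_def by (rule finite_supp_point)
  have "integ w (\<lambda>u. dheat w i u x * dheat w j u y) =
      integ w (\<lambda>u. (avg w ^^ i) (p x) u * (avg w ^^ j) (p y) u)"
    by (simp only: dheat_eq_avg_pow p_def)
  also have "\<dots> = integ w (\<lambda>u. p x u * dheat w (i + j) u y)"
    using integ_mult_avg_pow[OF fin finite_supp_avg_pow[OF fin], of x i j y]
    by (simp add: dheat_eq_avg_pow p_def funpow_add)
  also have "\<dots> = (\<Sum>u\<in>{x}. deg w u * (p x u * dheat w (i + j) u y))"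
    by (rule integ_eq_sum) (auto simp: supp_def p_def)
  finally show ?thesis by (simp add: p_def)
qed

lemma finite_supp_dheat: "finite (supp (\<lambda>u. dheat w i u x))"
  unfolding dheat_eq_avg_pow by (rule finite_supp_avg_pow[OF finite_supp_point])

text \<open>Up to the factor \<open>deg w z\<close>, the return probability at time
  \<open>2 * j\<close> is the squared norm of the \<open>j\<close>-th average of a point mass, and
  averaging is a contraction.\<close>

lemma dheat_even_antimono: "i \<le> j \<Longrightarrow> dheat w (2 * j) z z \<le> dheat w (2 * i) z z"
proof (induction j rule: dec_induct)
  case (step j)
  have "deg w z * dheat w (2 * Suc j) z z = integ w (\<lambda>u. (avg w (\<lambda>u. dheat w j u z) u)\<^sup>2)"
    using integ_dheat_mult_dheat[of "Suc j" z "Suc j" z]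
    unfolding dheat_Suc mult_2 by (simp only: power2_eq_square)
  also have "\<dots> \<le> integ w (\<lambda>u. (dheat w j u z)\<^sup>2)"
    by (rule integ_avg_power2_le[OF finite_supp_dheat])
  also have "\<dots> = deg w z * dheat w (2 * j) z z"
    using integ_dheat_mult_dheat[of j z j z] by (simp add: mult_2 power2_eq_square)
  finally show ?case
    using step.IH deg_pos[of z] by simp
qed simp

text \<open>Return probabilities at even times decrease, so the Poisson mixture that defines the
  kernel at time \<open>j / 2\<close> keeps a fixed share of the return probability at time \<open>2j\<close>;
  the factor in brackets is a lower bound for the indicator of even \<open>k \<le> 2j\<close> with
  computable mean.\<close>

lemma dheat_diag_le_hk:
  assumes "j \<ge> 1"
  shows "dheat w (2 * j) z z / deg w z \<le> 4 * hk (real j / 2) z z"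
proof -
  define N where "N = 2 * j"
  \<comment> \<open>At this time the Poisson mean of \<open>real k / real N\<close> is 1/4, while
    that of \<open>(1 + (- 1) ^ k) / 2\<close> is at least 1/2, because the alternating series sums
    to the positive number \<open>exp (- t)\<close>. The remaining 1/4 is the factor 4 of the
    claim.\<close>
  define t where "t = real j / 2"
  have N: "real N > 0" and t: "t > 0" and tN: "t / real N = 1 / 4"
    using assms by (auto simp: N_def t_def)
  define d where "d = dheat w N z z"
  have d: "d \<ge> 0" by (simp add: d_def dheat_nonneg)
  have le: "d * ((1 + (- 1) ^ k) / 2 - real k / real N) \<le> dheat w k z z" for k
  proof (cases "even k \<and> k \<le> N")
    case True
    then obtain i where i: "k = 2 * i" "i \<le> j" by (auto simp: N_def elim!: evenE)
    have "d * ((1 + (- 1) ^ k) / 2 - real k / real N) \<le> d * 1"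
      using True N d by (intro mult_left_mono) auto
    also have "\<dots> \<le> dheat w k z z"
      using dheat_even_antimono[OF i(2), of z] by (simp add: d_def N_def i)
    finally show ?thesis .
  next
    case False
    then have "(1 + (- 1) ^ k) / 2 - real k / real N \<le> 0"
      using N by (cases "even k") (auto simp: field_simps)
    then have "d * ((1 + (- 1) ^ k) / 2 - real k / real N) \<le> 0"
      using d by (intro mult_nonneg_nonpos)
    then show ?thesis
      using dheat_nonneg[of k z z] by linarith
  qed
  have 1: "(\<lambda>k. d / 2 * (t ^ k / fact k) + d / 2 * ((- t) ^ k / fact k)
      - d / real N * (t ^ k / fact k * real k))
      sums (d / 2 * exp t + d / 2 * exp (- t) - d / real N * (t * exp t))"
    by (intro sums_add sums_diff sums_mult exp_sums exp_mean_sums)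
  have main: "d / 2 * exp t + d / 2 * exp (- t) - d / real N * (t * exp t) \<le> exp t * deg w z * hk t z z"
  proof (rule sums_le[OF _ 1 hk_sums])
    fix k
    have "t ^ k / fact k * (d * ((1 + (- 1) ^ k) / 2 - real k / real N)) \<le> t ^ k / fact k * dheat w k z z"
      using le t by (intro mult_left_mono) auto
    moreover have "(- t) ^ k = (- 1) ^ k * t ^ k"
      by (metis mult_minus1 power_mult_distrib)
    ultimately show "d / 2 * (t ^ k / fact k) + d / 2 * ((- t) ^ k / fact k)
        - d / real N * (t ^ k / fact k * real k) \<le> t ^ k / fact k * dheat w k z z"
      by (simp add: algebra_simps add_divide_distrib diff_divide_distrib)
  qed
  have mean: "d / real N * (t * exp t) = d / 4 * exp t"
    using tN by (simp add: field_simps)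
  have "d / 2 * exp t - d / 4 * exp t \<le> d / 2 * exp t + d / 2 * exp (- t) - d / 4 * exp t"
    using d by simp
  also have "\<dots> \<le> exp t * deg w z * hk t z z"
    using main unfolding mean .
  finally have "d / 2 * exp t - d / 4 * exp t \<le> exp t * deg w z * hk t z z" .
  then have "exp t * (d / 4) \<le> exp t * (deg w z * hk t z z)"
    by (simp add: algebra_simps)
  then have "d / 4 \<le> deg w z * hk t z z"
    by simp
  then show ?thesis
    using deg_pos[of z] by (simp add: d_def N_def t_def field_simps)
qed

text \<open>The left-hand side is the inner product of two densities, after \<open>i\<close> steps
  from \<open>x\<close> and \<open>j\<close> steps from \<open>y\<close>, and a product is at most
  the mean of the squares. Unequal \<open>i\<close> and \<open>j\<close> reach the odd
  times.\<close>

lemma dheat_offdiag_le: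
  "dheat w (i + j) x y / deg w y
    \<le> (dheat w (2 * i) x x / deg w x + dheat w (2 * j) y y / deg w y) / 2"
proof -
  define F where "F u = 1 / deg w x * dheat w i u x" for u
  define G where "G u = 1 / deg w y * dheat w j u y" for u
  have fin: "finite (supp F)" "finite (supp G)"
    unfolding F_def G_def by (intro finite_supp_intros finite_supp_dheat)+
  have FG: "integ w (\<lambda>u. F u * G u) = dheat w (i + j) x y / deg w y"
  proof -
    have "(\<lambda>u. F u * G u) = (\<lambda>u. 1 / (deg w x * deg w y) * (dheat w i u x * dheat w j u y))"
      by (simp add: F_def G_def)
    then show ?thesis
      using integ_cmult[of "\<lambda>u. dheat w i u x * dheat w j u y" "1 / (deg w x * deg w y)"]
      by (simp add: finite_supp_intros finite_supp_dheat integ_dheat_mult_dheat)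
  qed
  have sq: "integ w (\<lambda>u. (1 / deg w x * dheat w i u x)\<^sup>2) = dheat w (2 * i) x x / deg w x" for i x
  proof -
    have "(\<lambda>u. (1 / deg w x * dheat w i u x)\<^sup>2) =
        (\<lambda>u. 1 / (deg w x * deg w x) * (dheat w i u x * dheat w i u x))"
      by (simp add: power2_eq_square)
    then show ?thesis
      using integ_cmult[of "\<lambda>u. dheat w i u x * dheat w i u x" "1 / (deg w x * deg w x)"]
      by (simp add: finite_supp_intros finite_supp_dheat integ_dheat_mult_dheat mult_2)
  qed
  have "integ w (\<lambda>u. F u * G u) \<le> integ w (\<lambda>u. 1 / 2 * ((F u)\<^sup>2 + (G u)\<^sup>2))"
  proof (rule integ_mono)
    show "F u * G u \<le> 1 / 2 * ((F u)\<^sup>2 + (G u)\<^sup>2)" for u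
      using sum_squares_bound[of "F u" "G u"] by simp
  qed (intro finite_supp_intros fin)+
  also have "\<dots> = 1 / 2 * (integ w (\<lambda>u. (F u)\<^sup>2) + integ w (\<lambda>u. (G u)\<^sup>2))"
    by (simp only: integ_cmult integ_add finite_supp_intros fin)
  finally show ?thesis
    unfolding FG unfolding F_def G_def sq by simp
qed

end

context kernel_bound
begin

lemma dheat_bound:
  assumes d: "d > 0" and deg_ge: "\<And>x. deg w x \<ge> d"
  shows "\<exists>C>0. \<forall>k\<ge>1. \<forall>x y. dheat w k x y / deg w y \<le> C * real k powr (- D / 2)"
proof -
  \<comment> \<open>The first entry serves \<open>k = 1\<close>, which cannot be split into two
    positive halves. Otherwise both halves \<open>j\<close> of \<open>k\<close> satisfy
    \<open>k \<le> 3 * j\<close>, the extreme case being \<open>k = 3\<close>, so the kernel is used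
    at a time of at least \<open>k / 6\<close>.\<close>
  define C where "C = max (1 / d) (4 * A * 6 powr (D / 2))"
  have C: "C > 0" "1 / d \<le> C" "4 * A * 6 powr (D / 2) \<le> C"
    using d by (auto simp: C_def less_max_iff_disj)
  have diag: "dheat w (2 * j) z z / deg w z \<le> C * real k powr (- D / 2)"
    if k: "k \<ge> 1" "k \<le> 3 * j" for j k z
  proof -
    have j: "j \<ge> 1" using k by simp
    have "dheat w (2 * j) z z / deg w z \<le> 4 * hk (real j / 2) z z"
      by (rule dheat_diag_le_hk[OF j])
    also have "\<dots> \<le> 4 * (A * (real j / 2) powr (- D / 2))"
      using j by (intro mult_left_mono hk_bound) auto
    also have "\<dots> \<le> 4 * (A * (real k / 6) powr (- D / 2))"
      using k j A_pos D_pos' by (intro mult_left_mono powr_mono2') auto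
    also have "\<dots> = 4 * A * 6 powr (D / 2) * real k powr (- D / 2)"
      using k by (simp add: powr_divide powr_minus_divide)
    also have "\<dots> \<le> C * real k powr (- D / 2)"
      by (intro mult_right_mono C) simp
    finally show ?thesis .
  qed
  have "dheat w k x y / deg w y \<le> C * real k powr (- D / 2)" if k: "k \<ge> 1" for k x y
  proof (cases "k = 1")
    case True
    have "dheat w k x y / deg w y \<le> 1 / d"
      using dheat_le_1[of k x y] dheat_nonneg[of k x y] deg_ge[of y] d by (intro frac_le) auto
    then show ?thesis using C(2) True by simp
  next
    case False
    define i where "i = k div 2"
    have i: "k \<le> 3 * i" "k \<le> 3 * (k - i)" "i + (k - i) = k"
      using k False by (auto simp: i_def)
    have mean: "(a + b) / 2 \<le> M" if "a \<le> M" "b \<le> M" for a b M :: real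
      using that by simp
    show ?thesis
      using dheat_offdiag_le[of i "k - i" x y] mean[OF diag[OF k i(1), of x] diag[OF k i(2), of y]]
      unfolding i(3) by (rule order.trans)
  qed
  then show ?thesis using C(1) by blast
qed

end

section \<open>Sobolev and logarithmic Sobolev inequalities\<close>

text \<open>The portion of the value \<open>a\<close> between the levels \<open>s * 2 ^ k\<close>
  and \<open>s * 2 ^ Suc k\<close>.\<close>

definition layer :: "real \<Rightarrow> nat \<Rightarrow> real \<Rightarrow> real" where
  "layer s k a = min (max (a - s * 2 ^ k) 0) (s * 2 ^ k)"

lemma sum_layer:
  assumes "s > 0"
  shows "(\<Sum>k<K. layer s k a) = min (max (a - s) 0) (s * 2 ^ K - s)"
proof (induction K)
  case (Suc K)
  define h where "h = s * 2 ^ K"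
  have "s * 1 \<le> s * 2 ^ K"
    using assms by (intro mult_left_mono) auto
  then have h: "s \<le> h" "s * 2 ^ Suc K = 2 * h"
    by (simp_all add: h_def)
  have "min (max (a - s) 0) (h - s) + min (max (a - h) 0) h = min (max (a - s) 0) (2 * h - s)"
    using h(1) assms by (auto simp: min_def max_def)
  then show ?case
    using Suc unfolding h(2) by (simp add: layer_def h_def)
qed simp

lemma layer_mono: "a \<le> b \<Longrightarrow> layer s k a \<le> layer s k b"
  by (auto simp: layer_def)

lemma sum_power2_le_power2_sum:
  fixes d :: "'a \<Rightarrow> real"
  assumes "\<And>i. i \<in> I \<Longrightarrow> d i \<ge> 0"
  shows "(\<Sum>i\<in>I. (d i)\<^sup>2) \<le> (\<Sum>i\<in>I. d i)\<^sup>2"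
  using assms
proof (induction I rule: infinite_finite_induct)
  case (insert i I)
  have "0 \<le> 2 * (d i * (\<Sum>i\<in>I. d i))"
    using insert by (intro mult_nonneg_nonneg sum_nonneg) auto
  then show ?case
    using insert by (simp add: power2_sum)
qed auto

text \<open>For \<open>a \<le> b\<close> the increments of the layers are nonnegative and add up to
  at most \<open>b - a\<close>, because the layers stack up to a truncation; the sum of their
  squares is at most the square of their sum.\<close>

lemma sum_layer_diff_le:
  assumes "s > 0"
  shows "(\<Sum>k<K. (layer s k b - layer s k a)\<^sup>2) \<le> (b - a)\<^sup>2"
proof -
  have *: "(\<Sum>k<K. (layer s k b - layer s k a)\<^sup>2) \<le> (b - a)\<^sup>2" if "a \<le> b" for a b
  proof -
    have "(\<Sum>k<K. (layer s k b - layer s k a)\<^sup>2) \<le> (\<Sum>k<K. layer s k b - layer s k a)\<^sup>2"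
      by (rule sum_power2_le_power2_sum) (simp add: layer_mono that)
    also have "\<dots> \<le> (b - a)\<^sup>2"
    proof (rule power_mono)
      show "(\<Sum>k<K. layer s k b - layer s k a) \<le> b - a"
        unfolding sum_subtractf sum_layer[OF assms] using that by (simp add: min_def max_def)
    qed (simp add: sum_nonneg layer_mono that)
    finally show ?thesis .
  qed
  show ?thesis
    using *[of a b] *[of b a] by (cases "a \<le> b") (auto simp: power2_commute)
qed

lemma dyadic_level:
  fixes s a :: real
  assumes "s < a" "a \<le> s * 2 ^ K"
  shows "\<exists>k<K. s * 2 ^ k < a \<and> a \<le> s * 2 ^ Suc k"
  using assms(2)
proof (induction K)
  case (Suc K)
  then show ?case
    by (cases "a \<le> s * 2 ^ K") (auto intro: less_SucI)
qed (use assms in simp)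

context wgraph
begin

lemma sum_Gam_layer_le:
  assumes "s > 0"
  shows "(\<Sum>k<K. Gam w (\<lambda>y. layer s k \<bar>f y\<bar>) (\<lambda>y. layer s k \<bar>f y\<bar>) x) \<le> Gam w f f x"
proof -
  have "(\<Sum>k<K. (layer s k \<bar>f y\<bar> - layer s k \<bar>f x\<bar>)\<^sup>2) \<le> (f y - f x)\<^sup>2" for y
  proof -
    have "(\<Sum>k<K. (layer s k \<bar>f y\<bar> - layer s k \<bar>f x\<bar>)\<^sup>2) \<le> (\<bar>f y\<bar> - \<bar>f x\<bar>)\<^sup>2"
      by (rule sum_layer_diff_le[OF assms])
    also have "\<dots> \<le> (f y - f x)\<^sup>2"
      by (simp only: abs_le_square_iff[symmetric] abs_triangle_ineq3)
    finally show ?thesis .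
  qed
  then have "(\<Sum>y\<in>nbrs w x. w x y * (\<Sum>k<K. (layer s k \<bar>f y\<bar> - layer s k \<bar>f x\<bar>)\<^sup>2))
      \<le> (\<Sum>y\<in>nbrs w x. w x y * (f y - f x)\<^sup>2)"
    using weight_nonneg by (intro sum_mono mult_left_mono) auto
  then have "1 / (2 * deg w x) * (\<Sum>y\<in>nbrs w x. w x y * (\<Sum>k<K. (layer s k \<bar>f y\<bar> - layer s k \<bar>f x\<bar>)\<^sup>2))
      \<le> 1 / (2 * deg w x) * (\<Sum>y\<in>nbrs w x. w x y * (f y - f x)\<^sup>2)"
    using deg_nonneg by (intro mult_left_mono) auto
  also have "1 / (2 * deg w x) * (\<Sum>y\<in>nbrs w x. w x y * (\<Sum>k<K. (layer s k \<bar>f y\<bar> - layer s k \<bar>f x\<bar>)\<^sup>2))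
      = (\<Sum>k<K. Gam w (\<lambda>y. layer s k \<bar>f y\<bar>) (\<lambda>y. layer s k \<bar>f y\<bar>) x)"
    unfolding Gam_def sum_distrib_left by (subst sum.swap) (simp add: power2_eq_square mult_ac)
  finally show ?thesis
    by (simp add: Gam_def power2_eq_square mult_ac)
qed

lemma integ_sum:
  assumes "finite I" "\<And>i. i \<in> I \<Longrightarrow> finite (supp (f i))"
  shows "integ w (\<lambda>x. \<Sum>i\<in>I. f i x) = (\<Sum>i\<in>I. integ w (f i)) \<and> finite (supp (\<lambda>x. \<Sum>i\<in>I. f i x))"
  using assms
proof (induction I rule: finite_induct)
  case empty
  then show ?case by (simp add: integ_def supp_def)
next
  case (insert i I)
  then show ?case
    by (simp add: integ_add finite_supp_add)
qed

end

locale faber_krahn = wgraph +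
  fixes c D :: real
  assumes c_pos: "c > 0" and D_gt_2: "D > 2"
    and faber_krahn: "\<And>\<Omega> f. finite \<Omega> \<Longrightarrow> supp f \<subseteq> \<Omega> \<Longrightarrow>
      integ w (\<lambda>x. (f x)\<^sup>2) \<le> c * vol w \<Omega> powr (2 / D) * integ w (Gam w f f)"
begin

definition q :: real where
  "q = 2 * D / (D - 2)"

lemma q_pos: "q > 0"
  using D_gt_2 by (simp add: q_def)

text \<open>Faber--Krahn is applied to the dyadic layers of \<open>\<bar>f\<bar>\<close>: on the set of points above the
  next level a layer equals its full height, and the energies of the layers add up to at
  most the energy of \<open>f\<close>.  As the exponents balance, the level volumes \<open>b k\<close>
  satisfy \<open>b (k + 1) \<le> const * b k powr (2 / D) * E k\<close>, which is summed over \<open>k\<close>.\<close>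

lemma sobolev:
  assumes f: "finite (supp f)"
  shows "(lpnorm w q f)\<^sup>2 \<le> 8 * 2 powr q * c * integ w (Gam w f f)"
proof (cases "supp f = {}")
  case True
  then have "f = (\<lambda>_. 0)" by (auto simp: supp_def)
  then show ?thesis by (simp add: lpnorm_def integ_def Gam_def)
next
  case False
  define F where "F = supp f"
  have F: "finite F" "F \<noteq> {}" using f False by (auto simp: F_def)
  \<comment> \<open>The divisor 4 puts both \<open>s\<close> and \<open>2 * s\<close> strictly below
    all nonzero values of \<open>\<bar>f x\<bar>\<close>. Hence \<open>U 0\<close> and
    \<open>U 1\<close> are the whole support and \<open>b 0 \<le> b 1\<close>, which absorbs the one
    term that the recursion does not reach.\<close>
  define s where "s = Min ((\<lambda>x. \<bar>f x\<bar>) ` F) / 4"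
  have min_pos: "Min ((\<lambda>x. \<bar>f x\<bar>) ` F) > 0"
    using F by (subst Min_gr_iff) (auto simp: F_def supp_def)
  have s: "s > 0" using min_pos by (simp add: s_def)
  have s_less: "2 * s < \<bar>f x\<bar>" if "x \<in> F" for x
  proof -
    have "4 * s \<le> \<bar>f x\<bar>"
      using F that by (simp add: s_def)
    then show ?thesis using s by simp
  qed
  obtain K0 where K0: "Max ((\<lambda>x. \<bar>f x\<bar>) ` F) / s < 2 ^ K0"
    using real_arch_pow[of 2] by auto
  \<comment> \<open>The successor makes \<open>K\<close> positive, so that \<open>b 1\<close> occurs
    among the terms \<open>b (Suc k)\<close> with \<open>k < K\<close>.\<close>
  define K where "K = Suc K0"
  have le_K: "\<bar>f x\<bar> \<le> s * 2 ^ K" if "x \<in> F" for x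
  proof -
    have "\<bar>f x\<bar> \<le> Max ((\<lambda>x. \<bar>f x\<bar>) ` F)"
      using F that by simp
    also have "\<dots> \<le> s * 2 ^ K0"
      using K0 s by (simp add: field_simps)
    also have "\<dots> \<le> s * 2 ^ K"
      using s by (simp add: K_def)
    finally show ?thesis .
  qed
  define \<tau> where "\<tau> k = s * 2 ^ k" for k :: nat
  have \<tau>: "\<tau> k > 0" "\<tau> (Suc k) = 2 * \<tau> k" for k
    using s by (auto simp: \<tau>_def)
  define U where "U k = {x\<in>F. \<tau> k < \<bar>f x\<bar>}" for k
  have U: "finite (U k)" "U k \<subseteq> F" for k
    using F by (auto simp: U_def)
  define g where "g k x = layer s k \<bar>f x\<bar>" for k x
  have supp_g: "supp (g k) \<subseteq> U k" for k
    using \<tau>(1)[of k] by (auto simp: supp_def g_def layer_def U_def F_def \<tau>_def max_def split: if_splits)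
  have fin_g: "finite (supp (g k))" for k
    using finite_subset[OF supp_g U(1)] .
  define E where "E k = integ w (Gam w (g k) (g k))" for k
  have E_nonneg: "E k \<ge> 0" for k
    unfolding E_def by (intro integ_nonneg Gam_nonneg)
  define b where "b k = \<tau> k powr q * vol w (U k)" for k
  have vol_nonneg: "vol w X \<ge> 0" for X
    unfolding vol_def by (intro sum_nonneg deg_nonneg)
  have b_nonneg: "b k \<ge> 0" for k
    by (simp add: b_def vol_nonneg)
  have sum_E: "(\<Sum>k<K. E k) \<le> integ w (Gam w f f)"
  proof -
    have "(\<Sum>k<K. E k) = integ w (\<lambda>x. \<Sum>k<K. Gam w (g k) (g k) x)"
      using integ_sum[of "{..<K}" "\<lambda>k. Gam w (g k) (g k)"] fin_g finite_supp_Gam by (simp add: E_def)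
    also have "\<dots> \<le> integ w (Gam w f f)"
    proof (rule integ_mono)
      show "finite (supp (\<lambda>x. \<Sum>k<K. Gam w (g k) (g k) x))"
        using integ_sum[of "{..<K}" "\<lambda>k. Gam w (g k) (g k)"] fin_g finite_supp_Gam by simp
      show "(\<Sum>k<K. Gam w (g k) (g k) x) \<le> Gam w f f x" for x
        unfolding g_def by (rule sum_Gam_layer_le[OF s])
    qed (rule finite_supp_Gam[OF f])
    finally show ?thesis .
  qed
  have step: "b (Suc k) \<le> 2 powr q * c * b k powr (2 / D) * E k" for k
  proof -
    have "(\<tau> k)\<^sup>2 * vol w (U (Suc k)) = (\<Sum>x\<in>U (Suc k). deg w x * (\<tau> k)\<^sup>2)"
      unfolding vol_def sum_distrib_left by (simp only: mult.commute)
    also have "\<dots> \<le> (\<Sum>x\<in>U (Suc k). deg w x * (g k x)\<^sup>2)"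
    proof (intro sum_mono mult_left_mono deg_nonneg)
      fix x assume "x \<in> U (Suc k)"
      then have "g k x = \<tau> k"
        using \<tau>(1)[of k] by (auto simp: U_def g_def layer_def \<tau>_def)
      then show "(\<tau> k)\<^sup>2 \<le> (g k x)\<^sup>2" by simp
    qed
    also have "\<dots> \<le> (\<Sum>x\<in>F. deg w x * (g k x)\<^sup>2)"
      by (rule sum_mono2) (use F U in \<open>auto simp: deg_nonneg\<close>)
    also have "\<dots> = integ w (\<lambda>x. (g k x)\<^sup>2)"
      using supp_g[of k] U(2)[of k] by (intro integ_eq_sum[symmetric] F) (auto simp: supp_def)
    also have "\<dots> \<le> c * vol w (U k) powr (2 / D) * E k"
      unfolding E_def by (rule faber_krahn[OF U(1) supp_g])
    finally have *: "(\<tau> k)\<^sup>2 * vol w (U (Suc k)) \<le> c * vol w (U k) powr (2 / D) * E k" .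
    \<comment> \<open>This identity singles out the Sobolev exponent: one part of the power of
      \<open>\<tau> k\<close> completes \<open>b k\<close>, the other is the squared height of the
      layer.\<close>
    have "q = q * (2 / D) + 2"
      using D_gt_2 by (simp add: q_def field_simps)
    then have \<tau>_q: "\<tau> k powr q = \<tau> k powr (q * (2 / D)) * (\<tau> k)\<^sup>2"
      using \<tau>(1)[of k] by (metis powr_add powr_numeral less_imp_le)
    have "b (Suc k) = 2 powr q * \<tau> k powr (q * (2 / D)) * ((\<tau> k)\<^sup>2 * vol w (U (Suc k)))"
      unfolding b_def \<tau>(2) powr_mult \<tau>_q by (simp only: mult_ac)
    also have "\<dots> \<le> 2 powr q * \<tau> k powr (q * (2 / D)) * (c * vol w (U k) powr (2 / D) * E k)"
      by (intro mult_left_mono *) simp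
    also have "\<dots> = 2 powr q * c * b k powr (2 / D) * E k"
      by (simp add: b_def powr_mult powr_powr)
    finally show ?thesis .
  qed
  have U_first: "U 0 = F" "U 1 = F"
    using s s_less by (force simp: U_def \<tau>_def)+
  have b_first: "b 0 \<le> b 1"
    unfolding b_def U_first using \<tau>[of 0] q_pos
    by (intro mult_right_mono powr_mono2 vol_nonneg) auto
  define B where "B = (\<Sum>k<Suc K. b k)"
  have "vol w F > 0"
    unfolding vol_def using F deg_pos by (intro sum_pos) auto
  then have "b 0 > 0"
    using \<tau>(1)[of 0] by (simp add: b_def U_first)
  moreover have "b 0 \<le> B"
    unfolding B_def by (rule member_le_sum) (auto simp: b_nonneg)
  ultimately have B_pos: "B > 0" by simp
  \<comment> \<open>With the total \<open>B\<close> in place of each \<open>b k\<close> a plain sum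
    of energies remains; as \<open>B\<close> is positive, \<open>B powr (2 / D)\<close> is then
    divided out.\<close>
  have b_le_B: "b k \<le> B" if "k < K" for k
    unfolding B_def by (rule member_le_sum) (use that in \<open>auto simp: b_nonneg\<close>)
  have "B = b 0 + (\<Sum>k<K. b (Suc k))"
    unfolding B_def by (rule sum.lessThan_Suc_shift)
  also have "b 0 \<le> (\<Sum>k<K. b (Suc k))"
  proof -
    have "b (Suc 0) \<le> (\<Sum>k<K. b (Suc k))"
      by (rule member_le_sum) (auto simp: b_nonneg K_def)
    then show ?thesis using b_first by simp
  qed
  finally have "B \<le> 2 * (\<Sum>k<K. b (Suc k))" by simp
  also have "(\<Sum>k<K. b (Suc k)) \<le> (\<Sum>k<K. 2 powr q * c * B powr (2 / D) * E k)"
  proof (intro sum_mono)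
    fix k assume "k \<in> {..<K}"
    have "b (Suc k) \<le> 2 powr q * c * b k powr (2 / D) * E k"
      by (rule step)
    also have "\<dots> \<le> 2 powr q * c * B powr (2 / D) * E k"
      using \<open>k \<in> {..<K}\<close> c_pos D_gt_2
      by (intro mult_right_mono mult_left_mono powr_mono2 b_le_B b_nonneg E_nonneg) auto
    finally show "b (Suc k) \<le> 2 powr q * c * B powr (2 / D) * E k" .
  qed
  also have "\<dots> = 2 powr q * c * B powr (2 / D) * (\<Sum>k<K. E k)"
    by (simp add: sum_distrib_left)
  also have "\<dots> \<le> 2 powr q * c * B powr (2 / D) * integ w (Gam w f f)"
    using c_pos by (intro mult_left_mono sum_E) auto
  finally have "B \<le> B powr (2 / D) * (2 * 2 powr q * c * integ w (Gam w f f))"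
    by (simp add: mult_ac)
  moreover have "B = B powr (2 / D) * B powr (1 - 2 / D)"
    using B_pos by (simp flip: powr_add)
  ultimately have B_le: "B powr (1 - 2 / D) \<le> 2 * 2 powr q * c * integ w (Gam w f f)"
    using B_pos by (metis mult_le_cancel_left_pos powr_gt_zero less_irrefl)
  define Q where "Q = (\<Sum>x\<in>F. deg w x * \<bar>f x\<bar> powr q)"
  \<comment> \<open>Each nonzero value of \<open>\<bar>f x\<bar>\<close> is at most twice the dyadic
    level just below it. The resulting factor \<open>2 powr q\<close> becomes 4 when the power
    \<open>2 / q\<close> is taken.\<close>
  have "Q \<le> (\<Sum>x\<in>F. deg w x * (2 powr q * (\<Sum>k<Suc K. if x \<in> U k then \<tau> k powr q else 0)))"
    unfolding Q_def
  proof (intro sum_mono mult_left_mono deg_nonneg)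
    fix x assume x: "x \<in> F"
    then obtain k where k: "k < K" "\<tau> k < \<bar>f x\<bar>" "\<bar>f x\<bar> \<le> \<tau> (Suc k)"
      using dyadic_level[of s "\<bar>f x\<bar>" K] s_less[OF x] le_K[OF x] s by (auto simp: \<tau>_def)
    have "\<bar>f x\<bar> powr q \<le> (2 * \<tau> k) powr q"
      using k(3) q_pos by (intro powr_mono2) (auto simp: \<tau>(2))
    also have "\<dots> = 2 powr q * (if x \<in> U k then \<tau> k powr q else 0)"
      using x k(2) by (simp add: U_def powr_mult)
    also have "\<dots> \<le> 2 powr q * (\<Sum>k<Suc K. if x \<in> U k then \<tau> k powr q else 0)"
      using k(1) by (intro mult_left_mono member_le_sum) auto
    finally show "\<bar>f x\<bar> powr q \<le> 2 powr q * (\<Sum>k<Suc K. if x \<in> U k then \<tau> k powr q else 0)" .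
  qed
  also have "\<dots> = 2 powr q * (\<Sum>k<Suc K. \<Sum>x\<in>F. if x \<in> U k then \<tau> k powr q * deg w x else 0)"
    by (subst sum.swap) (simp add: sum_distrib_left mult_ac if_distrib cong: if_cong del: sum.lessThan_Suc)
  also have "\<dots> = 2 powr q * B"
  proof -
    have "(\<Sum>x\<in>F. if x \<in> U k then \<tau> k powr q * deg w x else 0) = b k" for k
      using F(1) U(2)[of k] by (simp add: b_def vol_def sum_distrib_left sum.inter_restrict[symmetric] Int_absorb1)
    then show ?thesis by (simp add: B_def)
  qed
  finally have Q_le: "Q \<le> 2 powr q * B" .
  have Q_nonneg: "Q \<ge> 0"
    unfolding Q_def by (intro sum_nonneg) (simp add: deg_nonneg)
  have q2: "2 / q = 1 - 2 / D"
    using D_gt_2 by (simp add: q_def field_simps)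
  have "lpnorm w q f = Q powr (1 / q)"
    unfolding Q_def using q_pos by (intro lpnorm_eq_sum F) (auto simp: F_def)
  then have "(lpnorm w q f)\<^sup>2 = Q powr (1 - 2 / D)"
    by (simp add: power2_eq_square q2[symmetric] flip: powr_add)
  also have "\<dots> \<le> (2 powr q * B) powr (1 - 2 / D)"
    using D_gt_2 by (intro powr_mono2 Q_le Q_nonneg) simp
  also have "\<dots> = 4 * B powr (1 - 2 / D)"
    using q_pos by (simp add: powr_mult powr_powr q2[symmetric])
  also have "\<dots> \<le> 4 * (2 * 2 powr q * c * integ w (Gam w f f))"
    by (intro mult_left_mono B_le) simp
  finally show ?thesis by simp
qed

text \<open>Jensen for the function \<open>(f x / N) powr r\<close> under the probability weights
  \<open>deg w x * (f x)\<^sup>2 / X\<close>, carried out with the tangent of \<open>ln\<close> at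
  the mean \<open>a\<close>. This bounds the entropy by the logarithm of a quotient of norms, which
  Sobolev controls and a second tangent makes linear in the energy.\<close>

lemma log_sobolev:
  assumes f: "finite (supp f)" and nonneg: "\<And>x. f x \<ge> 0" and \<epsilon>: "\<epsilon> > 0"
  defines "c' \<equiv> 8 * 2 powr q * c"
  shows "integ w (\<lambda>x. (f x)\<^sup>2 * ln (f x)) - (lpnorm w 2 f)\<^sup>2 * ln (lpnorm w 2 f)
    \<le> \<epsilon> * integ w (Gam w f f)
      + (- D / 4 * (1 + ln (4 / (c' * D))) - D / 4 * ln \<epsilon>) * (lpnorm w 2 f)\<^sup>2"
proof (cases "supp f = {}")
  case True
  then have "f = (\<lambda>_. 0)" by (auto simp: supp_def)
  then show ?thesis by (simp add: lpnorm_def integ_def Gam_def)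
next
  case False
  define F where "F = supp f"
  have F: "finite F" "F \<noteq> {}" using f False by (auto simp: F_def)
  have f_pos: "f x > 0" if "x \<in> F" for x
    using that nonneg[of x] by (simp add: F_def supp_def order.not_eq_order_implies_strict)
  have c': "c' > 0" using c_pos by (simp add: c'_def)
  define X where "X = (\<Sum>x\<in>F. deg w x * (f x)\<^sup>2)"
  define N where "N = lpnorm w 2 f"
  define L where "L = lpnorm w q f"
  define Q where "Q = (\<Sum>x\<in>F. deg w x * f x powr q)"
  define r where "r = q - 2"
  have r: "r > 0" and r_eq: "r = 4 / (D - 2)"
    using D_gt_2 by (auto simp: r_def q_def field_simps)
  have X: "X > 0"
    unfolding X_def by (intro sum_pos F mult_pos_pos deg_pos zero_less_power f_pos)
  have Q: "Q > 0"
    unfolding Q_def using f_pos by (intro sum_pos F mult_pos_pos deg_pos) (simp add: less_imp_neq[THEN not_sym])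
  have "N = X powr (1 / 2)"
    unfolding N_def X_def using F
    by (subst lpnorm_eq_sum[OF F(1)]) (auto simp: F_def powr_numeral)
  then have N: "N > 0" "N\<^sup>2 = X"
    using X by (auto simp: powr_half_sqrt)
  have "L = Q powr (1 / q)"
    unfolding L_def Q_def using F nonneg q_pos
    by (subst lpnorm_eq_sum[OF F(1)]) (auto simp: F_def)
  then have L: "L > 0" "ln Q = q * ln L"
    using Q q_pos by (auto simp: ln_powr)
  define a where "a = Q / (N powr r * X)"
  have a: "a > 0" using Q N X by (simp add: a_def)
  have ln_a: "ln a = q / 2 * ln (L\<^sup>2 / X)"
  proof -
    have "ln X = 2 * ln N"
      using N by (simp flip: N(2) add: ln_realpow)
    then show ?thesis
      using Q N X L by (simp add: a_def ln_div ln_mult ln_powr ln_realpow r_def algebra_simps)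
  qed
  have "r * (\<Sum>x\<in>F. deg w x * ((f x)\<^sup>2 * (ln (f x) - ln N)))
      = (\<Sum>x\<in>F. deg w x * (f x)\<^sup>2 * ln ((f x / N) powr r))"
    unfolding sum_distrib_left using f_pos N
    by (intro sum.cong) (auto simp: ln_powr ln_div less_imp_neq[THEN not_sym] mult_ac)
  also have "\<dots> \<le> (\<Sum>x\<in>F. deg w x * (f x)\<^sup>2 * ((f x / N) powr r / a - 1 + ln a))"
  proof (intro sum_mono mult_left_mono)
    fix x assume x: "x \<in> F"
    have z: "(f x / N) powr r > 0"
      using f_pos[OF x] N by simp
    show "ln ((f x / N) powr r) \<le> (f x / N) powr r / a - 1 + ln a"
      using ln_le_minus_one[of "(f x / N) powr r / a"] z a by (simp add: ln_div)
  qed (simp add: deg_nonneg)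
  also have "\<dots> = (\<Sum>x\<in>F. 1 / (N powr r * a) * (deg w x * f x powr q) + (ln a - 1) * (deg w x * (f x)\<^sup>2))"
  proof (intro sum.cong refl)
    fix x assume x: "x \<in> F"
    have "f x powr q = (f x)\<^sup>2 * f x powr r"
      using f_pos[OF x] by (simp add: r_def powr_diff powr_numeral)
    then show "deg w x * (f x)\<^sup>2 * ((f x / N) powr r / a - 1 + ln a)
        = 1 / (N powr r * a) * (deg w x * f x powr q) + (ln a - 1) * (deg w x * (f x)\<^sup>2)"
      by (simp add: powr_divide algebra_simps)
  qed
  also have "\<dots> = 1 / (N powr r * a) * Q + (ln a - 1) * X"
    by (simp only: sum.distrib X_def Q_def sum_distrib_left)
  also have "1 / (N powr r * a) * Q = X"
    using Q N X by (simp add: a_def)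
  finally have "r * (\<Sum>x\<in>F. deg w x * ((f x)\<^sup>2 * (ln (f x) - ln N))) \<le> X * ln a"
    by (simp add: algebra_simps)
  moreover have "(\<Sum>x\<in>F. deg w x * ((f x)\<^sup>2 * (ln (f x) - ln N)))
      = integ w (\<lambda>x. (f x)\<^sup>2 * ln (f x)) - X * ln N"
    by (subst integ_eq_sum[OF F(1)])
       (auto simp: F_def supp_def X_def sum_distrib_left algebra_simps sum_subtractf)
  ultimately have "r * (integ w (\<lambda>x. (f x)\<^sup>2 * ln (f x)) - X * ln N) \<le> X * ln a"
    by simp
  then have "integ w (\<lambda>x. (f x)\<^sup>2 * ln (f x)) - X * ln N \<le> X * ln a / r"
    using r by (simp add: field_simps)
  \<comment> \<open>Here \<open>q / (2 * r) = D / 4\<close>, the origin of the coefficient of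
    \<open>ln \<epsilon>\<close> in the claim.\<close>
  also have "\<dots> = X * (D / 4) * ln (L\<^sup>2 / X)"
    using D_gt_2 by (simp add: ln_a r_eq q_def field_simps)
  also have "\<dots> \<le> X * (D / 4) * (4 * \<epsilon> / (c' * D) * (c' * integ w (Gam w f f) / X) - 1 - ln (4 * \<epsilon> / (c' * D)))"
  proof (intro mult_left_mono)
    \<comment> \<open>The slope for which the Sobolev bound, multiplied by \<open>D / 4\<close>,
      contributes exactly \<open>\<epsilon>\<close> times the energy.\<close>
    define \<delta> where "\<delta> = 4 * \<epsilon> / (c' * D)"
    have \<delta>: "\<delta> > 0" using \<epsilon> c' D_gt_2 by (simp add: \<delta>_def)
    define y where "y = L\<^sup>2 / X"
    have y: "y > 0" using L X by (simp add: y_def)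
    have "y \<le> c' * integ w (Gam w f f) / X"
      unfolding y_def L_def c'_def using X by (intro divide_right_mono sobolev f) simp
    then have "\<delta> * y \<le> \<delta> * (c' * integ w (Gam w f f) / X)"
      using \<delta> by (intro mult_left_mono) auto
    moreover have "ln \<delta> + ln y \<le> \<delta> * y - 1"
      using ln_le_minus_one[of "\<delta> * y"] \<delta> y by (simp add: ln_mult)
    ultimately show "ln (L\<^sup>2 / X) \<le> 4 * \<epsilon> / (c' * D) * (c' * integ w (Gam w f f) / X) - 1 - ln (4 * \<epsilon> / (c' * D))"
      unfolding \<delta>_def[symmetric] y_def[symmetric] by linarith
  qed (use X D_gt_2 in simp)
  also have "\<dots> = \<epsilon> * integ w (Gam w f f) + (- D / 4 * (1 + ln (4 / (c' * D))) - D / 4 * ln \<epsilon>) * X"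
  proof -
    have "ln (4 * \<epsilon> / (c' * D)) = ln (4 / (c' * D)) + ln \<epsilon>"
      using \<epsilon> c' D_gt_2 by (simp add: ln_mult flip: times_divide_eq_left)
    moreover have "X * (D / 4) * (4 * \<epsilon> / (c' * D) * (c' * integ w (Gam w f f) / X)) = \<epsilon> * integ w (Gam w f f)"
      using X c' D_gt_2 by simp
    ultimately show ?thesis
      by (simp only: right_diff_distrib) (simp add: algebra_simps)
  qed
  finally show ?thesis
    by (simp add: N(2) flip: N_def)
qed

end

section \<open>Assembly of the six inequalities\<close>

theorem theorem2p2:
  fixes w :: "'v \<Rightarrow> 'v \<Rightarrow> real" and n \<alpha> C D c\<^sub>0 :: real
  assumes "weighted_graph w"
    and "n > 0" and "\<alpha> > 0"
    and "CDE' w n 0"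
    and "Delta_cond w \<alpha>"
    and doubling: "\<And>x r. r > 0 \<Longrightarrow> vol w (gball w x (2 * r)) \<le> C * vol w (gball w x r)"
    and "D = log 2 C" and "D > 2"
    and "c\<^sub>0 > 0"
    and growth: "\<And>x r. r \<ge> 0 \<Longrightarrow> vol w (gball w x r) \<ge> c\<^sub>0 * r powr D"
  shows
    "(\<exists>c>0. \<forall>f. finite (supp f) \<longrightarrow>
        (lpnorm w (2 * D / (D - 2)) f)\<^sup>2 \<le> c * integ w (Gam w f f)) \<and>
     (\<exists>c>0. \<forall>f. finite (supp f) \<longrightarrow>
        lpnorm w 2 f powr (2 + 4 / D) \<le> c * integ w (Gam w f f) * lpnorm w 1 f powr (4 / D)) \<and>
     (\<exists>c>0. \<forall>\<Omega>. \<Omega> \<noteq> {} \<longrightarrow> finite \<Omega> \<longrightarrow>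
        eigen1 w \<Omega> \<ge> c * vol w \<Omega> powr (- 2 / D)) \<and>
     (\<exists>C'>0. \<forall>k::nat. k \<ge> 1 \<longrightarrow>
        (SUP (x, y)\<in>UNIV. ereal (dheat w k x y / deg w y)) \<le> ereal (C' * real k powr (- D / 2))) \<and>
     (\<exists>C'>0. \<forall>t::real. t > 0 \<longrightarrow>
        (SUP (x, y)\<in>UNIV. ereal (heat_kernel w t x y)) \<le> ereal (C' * t powr (- D / 2))) \<and>
     (\<exists>c. \<forall>\<epsilon>>0. \<forall>f. finite (supp f) \<longrightarrow> (\<forall>x. f x \<ge> 0) \<longrightarrow>
        integ w (\<lambda>x. (f x)\<^sup>2 * ln (f x)) - (lpnorm w 2 f)\<^sup>2 * ln (lpnorm w 2 f)
          \<le> \<epsilon> * integ w (Gam w f f) + (c - D / 4 * ln \<epsilon>) * (lpnorm w 2 f)\<^sup>2)"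
proof -
  interpret volume_growth w c\<^sub>0 D
    using assms by unfold_locales auto
  obtain A where A: "A > 0" "\<And>t x z. t > 0 \<Longrightarrow> hk t x z \<le> A * t powr (- D / 2)"
    using hk_upper_bound[OF \<open>CDE' w n 0\<close> \<open>n > 0\<close> \<open>Delta_cond w \<alpha>\<close> \<open>\<alpha> > 0\<close>] by blast
  interpret kernel_bound w A D
    using A D_pos by unfold_locales auto
  define cF where "cF = 2 * (2 * A) powr (2 / D)"
  have cF: "cF > 0" using A(1) by (simp add: cF_def)
  interpret FK: faber_krahn w cF D
    using \<open>D > 2\<close> cF faber_krahn by unfold_locales (auto simp: cF_def)
  have norm_2: "(lpnorm w 2 f)\<^sup>2 = integ w (\<lambda>x. (f x)\<^sup>2)" and
    norm_2_powr: "lpnorm w 2 f powr (2 + 4 / D) = integ w (\<lambda>x. (f x)\<^sup>2) powr (1 + 2 / D)" and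
    norm_1: "lpnorm w 1 f = integ w (\<lambda>x. \<bar>f x\<bar>)" if f: "finite (supp f)" for f
  proof -
    have X: "integ w (\<lambda>x. (f x)\<^sup>2) \<ge> 0" and S: "integ w (\<lambda>x. \<bar>f x\<bar>) \<ge> 0"
      by (auto intro: integ_nonneg)
    have *: "lpnorm w 2 f = integ w (\<lambda>x. (f x)\<^sup>2) powr (1 / 2)"
      by (subst lpnorm_eq_sum[OF f], simp, simp, subst integ_eq_sum[OF f])
         (auto simp: supp_def)
    show "(lpnorm w 2 f)\<^sup>2 = integ w (\<lambda>x. (f x)\<^sup>2)"
      using X by (simp add: * powr_half_sqrt)
    show "lpnorm w 2 f powr (2 + 4 / D) = integ w (\<lambda>x. (f x)\<^sup>2) powr (1 + 2 / D)"
      by (simp add: * powr_powr distrib_left)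
    show "lpnorm w 1 f = integ w (\<lambda>x. \<bar>f x\<bar>)"
      using S by (subst lpnorm_eq_sum[OF f], simp, simp, subst (asm) integ_eq_sum[OF f], simp add: supp_def,
          subst integ_eq_sum[OF f]) (auto simp: supp_def)
  qed
  have sobolev: "\<exists>c>0. \<forall>f. finite (supp f) \<longrightarrow>
      (lpnorm w (2 * D / (D - 2)) f)\<^sup>2 \<le> c * integ w (Gam w f f)"
    using FK.sobolev cF unfolding FK.q_def
    by (intro exI[of _ "8 * 2 powr (2 * D / (D - 2)) * cF"]) simp
  have nash: "\<exists>c>0. \<forall>f. finite (supp f) \<longrightarrow>
      lpnorm w 2 f powr (2 + 4 / D) \<le> c * integ w (Gam w f f) * lpnorm w 1 f powr (4 / D)"
    using nash cF by (intro exI[of _ cF]) (simp add: cF_def norm_2_powr norm_1)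
  have eigen: "\<exists>c>0. \<forall>\<Omega>. \<Omega> \<noteq> {} \<longrightarrow> finite \<Omega> \<longrightarrow> eigen1 w \<Omega> \<ge> c * vol w \<Omega> powr (- 2 / D)"
  proof (intro exI[of _ "1 / cF"] conjI allI impI)
    fix \<Omega> :: "'v set" assume \<Omega>: "\<Omega> \<noteq> {}" "finite \<Omega>"
    have V: "vol w \<Omega> > 0"
      unfolding vol_def using \<Omega> deg_pos by (intro sum_pos) auto
    \<comment> \<open>The infimum of an empty set of reals would carry no information, so the set of
      quotients must be nonempty.\<close>
    have point: "\<exists>f. f \<noteq> (\<lambda>_. 0 :: real) \<and> supp f \<subseteq> \<Omega>"
    proof -
      obtain z where "z \<in> \<Omega>" using \<Omega> by blast
      then show ?thesis
        by (intro exI[of _ "\<lambda>y. if y = z then 1 else 0"]) (auto simp: supp_def fun_eq_iff)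
    qed
    show "1 / cF * vol w \<Omega> powr (- 2 / D) \<le> eigen1 w \<Omega>"
      unfolding eigen1_def
    proof (rule cInf_greatest)
      fix e assume "e \<in> {integ w (Gam w f f) / (lpnorm w 2 f)\<^sup>2 | f. f \<noteq> (\<lambda>_. 0) \<and> supp f \<subseteq> \<Omega>}"
      then obtain f where e: "e = integ w (Gam w f f) / (lpnorm w 2 f)\<^sup>2"
        and f: "f \<noteq> (\<lambda>_. 0)" "supp f \<subseteq> \<Omega>" by blast
      have fin: "finite (supp f)" using f(2) \<Omega>(2) finite_subset by blast
      have "integ w (\<lambda>x. (f x)\<^sup>2) > 0"
      proof -
        obtain z where "f z \<noteq> 0" using f(1) by auto
        then show ?thesis
          using integ_eq_sum[OF fin, of "\<lambda>x. (f x)\<^sup>2"] fin deg_pos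
          by (simp add: supp_def) (rule sum_pos, auto)
      qed
      moreover have "integ w (\<lambda>x. (f x)\<^sup>2) \<le> cF * vol w \<Omega> powr (2 / D) * integ w (Gam w f f)"
        using faber_krahn[OF \<Omega>(2) f(2)] by (simp add: cF_def)
      ultimately show "1 / cF * vol w \<Omega> powr (- 2 / D) \<le> e"
        using V cF by (simp add: e norm_2[OF fin] powr_minus_divide field_simps)
    qed (use point in blast)
  qed (use cF in simp)
  have discrete: "\<exists>C'>0. \<forall>k::nat. k \<ge> 1 \<longrightarrow>
      (SUP (x, y)\<in>UNIV. ereal (dheat w k x y / deg w y)) \<le> ereal (C' * real k powr (- D / 2))"
  proof -
    obtain C' where "C' > 0" "\<And>k x y. k \<ge> 1 \<Longrightarrow> dheat w k x y / deg w y \<le> C' * real k powr (- D / 2)"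
      using dheat_bound[OF deg_min_pos deg_ge] by blast
    then show ?thesis
      by (intro exI[of _ C'] conjI allI impI SUP_least) auto
  qed
  have heat: "\<exists>C'>0. \<forall>t::real. t > 0 \<longrightarrow>
      (SUP (x, y)\<in>UNIV. ereal (heat_kernel w t x y)) \<le> ereal (C' * t powr (- D / 2))"
    using A heat_kernel_eq_hk[OF deg_min_pos deg_ge]
    by (intro exI[of _ A] conjI allI impI SUP_least) auto
  have log_sobolev: "\<exists>c. \<forall>\<epsilon>>0. \<forall>f. finite (supp f) \<longrightarrow> (\<forall>x. f x \<ge> 0) \<longrightarrow>
      integ w (\<lambda>x. (f x)\<^sup>2 * ln (f x)) - (lpnorm w 2 f)\<^sup>2 * ln (lpnorm w 2 f)
        \<le> \<epsilon> * integ w (Gam w f f) + (c - D / 4 * ln \<epsilon>) * (lpnorm w 2 f)\<^sup>2"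
    using FK.log_sobolev by blast
  show ?thesis
    using sobolev nash eigen discrete heat log_sobolev by blast
qed

end
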